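(* Let $\Pi$ be a problem with derived problems $\Pi_1$ and $\Pi'_1$ (as in the context). Let $\mathcal G_{n,\Delta}$ be a $\Sigma$-input-labeled graph class of $n$-node graphs with maximum degree $\Delta$, assume $\mathcal G_{n,\Delta}$ is $t$-independent for some positive integer $t$ and contains only graphs of girth at least $2t+2$. Let $S\subseteq\mathbb N^+$ be a finite set of identifiers with $|S|\ge 4\Delta^{2t}$, and let $\mathcal G'_{n,\Delta}$ be the class of all input-labeled graphs obtained from a graph in $\mathcal G_{n,\Delta}$ by assigning unique identifiers from $S$ to its nodes (as additional input). Then the following are equivalent: (1) There is an order-invariant algorithm solving $\Pi$ on $\mathcal G'_{n,\Delta}$ in time $t$. (2) There is an order-invariant algorithm solving $\Pi_1$ on $\mathcal G'_{n,\Delta}$ in time $t-1$. (3) There is an order-invariant algorithm solving $\Pi'_1$ on $\mathcal G'_{n,\Delta}$ in time $t-1$.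
   Context: All graphs are simple, undirected and connected; $B(G)$ is the set of pairs $(v,e)$ with $v$ an endpoint of edge $e$. Multisets ignore order; $2^S$ is the power set. Input labels: a set $\Sigma$ with finite $\Sigma_{n,\Delta}\subseteq\Sigma$; a $\Sigma$-input-labeled graph ($n$ nodes, max degree $\Delta$) carries $\varphi_G:B(G)\to\Sigma_{n,\Delta}$. Problems: $\Pi=(\mathcal O,f,g,h)$ with $f(\Delta)\subseteq\mathcal O$ finite, $g(\Delta)$ a set of 2-element multisets over $f(\Delta)$, $h(\Delta)$ a set of multisets of at most $\Delta$ elements of $f(\Delta)$. An algorithm solves $\Pi$ on a class if on each graph of max degree $\Delta$ it outputs $o_{v,e}\in f(\Delta)$ at every $(v,e)\in B(G)$ such that $\{o_{u,e},o_{v,e}\}\in g(\Delta)$ for each edge $e=\{u,v\}$ and the multiset of outputs at each node lies in $h(\Delta)$. Model: port numbering model (nodes know $n,\Delta$, and their input labels per port; synchronous rounds, unbounded messages and computation); a $t$-round algorithm maps radius-$t$ neighborhoods (topology, ports, inputs) to one output per port. An algorithm on graphs with node identifiers is order-invariant if the output of each node depends only on the relative order of the identifiers it sees (and on the other input information), i.e., changing the identifiers in its view to other ones with the same relative order does not change its output. Neighborhoods: $N^t(v)$ = information $v$ gathers in $t$ rounds; $N^t(e)=N^t(u)\cap N^t(v)$; $\mathrm{ext}^t_e(v)=N^t(e)\setminus N^{t-1}(v)$; $\mathrm{ext}^t_v(e)=N^t(v)\setminus N^t(e)$. $t$-independence of $\mathcal G_{n,\Delta}$: for every $G$ in the class,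 node $v$, edge $e=\{u,v\}$: (i) any extension of $N^t_G(e)$ along $v$ realized in some graph of the class and any extension along $u$ realized in some graph of the class are realized simultaneously around one edge $e'$ of one graph $H$ of the class with $N^t_H(e')\cong N^t_G(e)$; (ii) for any choice, for every edge $e'$ incident to $v$, of an extension of $N^{t-1}_G(v)$ along $e'$ realized in some graph of the class, all chosen extensions are realized simultaneously at one node $w$ of one graph $H$ of the class with $N^{t-1}_H(w)\cong N^{t-1}_G(v)$. Derived problems: $\Pi_{1/2}$: $f_{1/2}(\Delta)=2^{f(\Delta)}$; $\{Y,Z\}\in g_{1/2}(\Delta)$ iff (P) $\{y,z\}\in g(\Delta)$ for all $y\in Y,z\in Z$; $\{Y_1,\dots,Y_i\}\in h_{1/2}(\Delta)$ ($i\le\Delta$) iff some $y_j\in Y_j$ give $\{y_1,\dots,y_i\}\in h(\Delta)$. $\Pi_1$: $f_1(\Delta)=2^{f_{1/2}(\Delta)}$; $\{Y,Z\}\in g_1(\Delta)$ iff some $y\in Y,z\in Z$ give $\{y,z\}\in g_{1/2}(\Delta)$; $\{Y_1,\dots,Y_i\}\in h_1(\Delta)$ iff (Q) $\{y_1,\dots,y_i\}\in h_{1/2}(\Delta)$ for all $y_j\in Y_j$. Simplified versions: $\Pi'_{1/2}$ is $\Pi_{1/2}$ with $g_{1/2}$ replaced by $g'_{1/2}(\Delta)$ = multisets satisfying (P) with $Y$ and $Z$ each inclusion-maximal subject to (P) (the other set fixed); $\Pi'_1$ is obtained from $\Pi'_{1/2}$ as $\Pi_1$ from $\Pi_{1/2}$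 (i.e., using $g'_{1/2}$ in the definition of $g_1$), with $h_1$ replaced by the multisets satisfying (Q) in which each $Y_j$ is inclusion-maximal subject to (Q) (others fixed). *)

theory Defs
  imports Main "HOL-Library.Multiset"
begin

section \<open>Problems and derived problems (at the level of a fixed maximum degree argument)\<close>

text \<open>A problem Pi = (O, f, g, h): the type 'o plays the role of O.\<close>
record 'o lcl_problem =
  outs  :: "nat \<Rightarrow> 'o set"            (* f *)
  edgec :: "nat \<Rightarrow> 'o multiset set"    (* g *)
  nodec :: "nat \<Rightarrow> 'o multiset set"    (* h *)

definition wf_problem :: "'o lcl_problem \<Rightarrow> bool" where
  "wf_problem P \<longleftrightarrow> (\<forall>D.
      finite (outs P D) \<and>
      (\<forall>M\<in>edgec P D. size M = 2 \<and> set_mset M \<subseteq> outs P D) \<and>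
      (\<forall>M\<in>nodec P D. size M \<le> D \<and> set_mset M \<subseteq> outs P D))"

text \<open>Property (P): all pairs are edge-compatible.\<close>
definition allcomp :: "'o lcl_problem \<Rightarrow> nat \<Rightarrow> 'o set \<Rightarrow> 'o set \<Rightarrow> bool" where
  "allcomp P D Y Z \<longleftrightarrow> (\<forall>y\<in>Y. \<forall>z\<in>Z. {#y, z#} \<in> edgec P D)"

text \<open>Pi_{1/2}\<close>
definition half :: "'o lcl_problem \<Rightarrow> 'o set lcl_problem" where
  "half P = \<lparr> outs = (\<lambda>D. Pow (outs P D)),
     edgec = (\<lambda>D. {M. \<exists>Y Z. M = {#Y, Z#} \<and> Y \<subseteq> outs P D \<and> Z \<subseteq> outs P D \<and> allcomp P D Y Z}),
     nodec = (\<lambda>D. {M. size M \<le> D \<and> set_mset M \<subseteq> Pow (outs P D) \<and>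
                     (\<exists>N\<in>nodec P D. rel_mset (\<lambda>Y y. y \<in> Y) M N)}) \<rparr>"

text \<open>Pi'_{1/2}: edge constraint restricted to pairs maximal w.r.t. (P).\<close>
definition half' :: "'o lcl_problem \<Rightarrow> 'o set lcl_problem" where
  "half' P = \<lparr> outs = (\<lambda>D. Pow (outs P D)),
     edgec = (\<lambda>D. {M. \<exists>Y Z. M = {#Y, Z#} \<and> Y \<subseteq> outs P D \<and> Z \<subseteq> outs P D \<and> allcomp P D Y Z
                    \<and> (\<forall>Y'. Y \<subset> Y' \<and> Y' \<subseteq> outs P D \<longrightarrow> \<not> allcomp P D Y' Z)
                    \<and> (\<forall>Z'. Z \<subset> Z' \<and> Z' \<subseteq> outs P D \<longrightarrow> \<not> allcomp P D Y Z')}),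
     nodec = nodec (half P) \<rparr>"

text \<open>Property (Q) for a multiset of sets w.r.t. a node constraint.\<close>
definition allnode :: "'o lcl_problem \<Rightarrow> nat \<Rightarrow> 'o set multiset \<Rightarrow> bool" where
  "allnode Q D M \<longleftrightarrow> (\<forall>N. rel_mset (\<lambda>Y y. y \<in> Y) M N \<longrightarrow> N \<in> nodec Q D)"

text \<open>Pi_1 obtained from Pi_{1/2} (the argument Q is Pi_{1/2} or Pi'_{1/2}).\<close>
definition one_from :: "'o lcl_problem \<Rightarrow> 'o set lcl_problem" where
  "one_from Q = \<lparr> outs = (\<lambda>D. Pow (outs Q D)),
     edgec = (\<lambda>D. {M. \<exists>Y Z. M = {#Y, Z#} \<and> Y \<subseteq> outs Q D \<and> Z \<subseteq> outs Q D \<and>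
                     (\<exists>y\<in>Y. \<exists>z\<in>Z. {#y, z#} \<in> edgec Q D)}),
     nodec = (\<lambda>D. {M. size M \<le> D \<and> set_mset M \<subseteq> Pow (outs Q D) \<and> allnode Q D M}) \<rparr>"

definition one :: "'o lcl_problem \<Rightarrow> 'o set set lcl_problem" where
  "one P = one_from (half P)"

text \<open>Pi'_1: from Pi'_{1/2}, with node constraint restricted to multisets whose
  elements are each inclusion-maximal subject to (Q) (others fixed).\<close>
definition one' :: "'o lcl_problem \<Rightarrow> 'o set set lcl_problem" where
  "one' P = \<lparr> outs = outs (one_from (half' P)),
     edgec = edgec (one_from (half' P)),
     nodec = (\<lambda>D. {M. M \<in> nodec (one_from (half' P)) D \<and>
                 (\<forall>Y\<in>#M. \<forall>Y'. Y \<subset> Y' \<and> Y' \<subseteq> outs (half' P) D \<longrightarrow>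
                      \<not> allnode (half' P) D (add_mset Y' (M - {#Y#})))}) \<rparr>"

section \<open>Port-numbered input-labeled graphs\<close>

text \<open>Node v has ports 0..<deg v; port i leads to neighbour nbr v i; the input label at
  (v, e) with e the edge behind port i is inp v i.\<close>
record ('v, 'l) pgraph =
  verts :: "'v set"
  deg   :: "'v \<Rightarrow> nat"
  nbr   :: "'v \<Rightarrow> nat \<Rightarrow> 'v"
  inp   :: "'v \<Rightarrow> nat \<Rightarrow> 'l"

definition adj :: "('v, 'l) pgraph \<Rightarrow> 'v \<Rightarrow> 'v \<Rightarrow> bool" where
  "adj G u v \<longleftrightarrow> (\<exists>i<deg G u. nbr G u i = v)"

text \<open>Port number at the other endpoint of the edge behind port i of v.\<close>
definition backport :: "('v, 'l) pgraph \<Rightarrow> 'v \<Rightarrow> nat \<Rightarrow> nat" where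
  "backport G v i = (SOME j. j < deg G (nbr G v i) \<and> nbr G (nbr G v i) j = v)"

text \<open>Simple, connected, port-numbered, Sigma-input-labeled graph with n nodes and
  maximum degree Delta.\<close>
definition in_graph_class :: "nat \<Rightarrow> nat \<Rightarrow> 'l set \<Rightarrow> ('v, 'l) pgraph \<Rightarrow> bool" where
  "in_graph_class n D Sig G \<longleftrightarrow>
     finite (verts G) \<and> card (verts G) = n \<and>
     (\<forall>v\<in>verts G. \<forall>i<deg G v. nbr G v i \<in> verts G \<and> nbr G v i \<noteq> v) \<and>
     (\<forall>v\<in>verts G. inj_on (nbr G v) {..<deg G v}) \<and>
     (\<forall>v\<in>verts G. \<forall>i<deg G v. adj G (nbr G v i) v) \<and>
     (\<forall>u\<in>verts G. \<forall>w\<in>verts G. (u, w) \<in> {(x, y). adj G x y}\<^sup>*) \<and>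
     (\<forall>v\<in>verts G. deg G v \<le> D) \<and> (\<exists>v\<in>verts G. deg G v = D) \<and>
     (\<forall>v\<in>verts G. \<forall>i<deg G v. inp G v i \<in> Sig)"

definition is_cycle :: "('v, 'l) pgraph \<Rightarrow> 'v list \<Rightarrow> bool" where
  "is_cycle G cs \<longleftrightarrow> length cs \<ge> 3 \<and> distinct cs \<and> set cs \<subseteq> verts G \<and>
     (\<forall>k<length cs. adj G (cs ! k) (cs ! ((k + 1) mod length cs)))"

definition girth_ge :: "('v, 'l) pgraph \<Rightarrow> nat \<Rightarrow> bool" where
  "girth_ge G m \<longleftrightarrow> (\<forall>cs. is_cycle G cs \<longrightarrow> length cs \<ge> m)"

section \<open>Views (information gathered in t rounds)\<close>

text \<open>A view: node label (identifier, or unit), input labels per port, and per port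
  either nothing (excluded direction / not yet explored) or the remote port number together
  with the view of the neighbour.  Depth-0 views have an empty child list.\<close>
datatype ('a, 'l) view = View 'a "'l list" "(nat \<times> ('a, 'l) view) option list"

text \<open>pview k G a v ex: radius-k view of v, not exploring through port ex.\<close>
primrec pview :: "nat \<Rightarrow> ('v, 'l) pgraph \<Rightarrow> ('v \<Rightarrow> 'a) \<Rightarrow> 'v \<Rightarrow> nat option \<Rightarrow> ('a, 'l) view" where
  "pview 0 G a v ex = View (a v) (map (inp G v) [0..<deg G v]) []"
| "pview (Suc k) G a v ex = View (a v) (map (inp G v) [0..<deg G v])
     (map (\<lambda>i. if ex = Some i then None
               else Some (backport G v i, pview k G a (nbr G v i) (Some (backport G v i))))
          [0..<deg G v])"

text \<open>N^t(v) for graphs without identifiers.\<close>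
definition nview :: "nat \<Rightarrow> ('v, 'l) pgraph \<Rightarrow> 'v \<Rightarrow> (unit, 'l) view" where
  "nview t G v = pview t G (\<lambda>_. ()) v None"

text \<open>N^t(e) for the edge e behind port i of v (oriented from v), = N^t(v) \<inter> N^t(u).\<close>
definition edge_view :: "nat \<Rightarrow> ('v, 'l) pgraph \<Rightarrow> 'v \<Rightarrow> nat \<Rightarrow>
    (unit, 'l) view \<times> nat \<times> nat \<times> (unit, 'l) view" where
  "edge_view t G v i = (pview (t - 1) G (\<lambda>_. ()) v (Some i), i, backport G v i,
      pview (t - 1) G (\<lambda>_. ()) (nbr G v i) (Some (backport G v i)))"

definition t_independent :: "('v, 'l) pgraph set \<Rightarrow> nat \<Rightarrow> bool" where
  "t_independent C t \<longleftrightarrow>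
    (\<forall>G\<in>C. \<forall>v\<in>verts G. \<forall>i<deg G v. \<forall>H1\<in>C. \<forall>v1\<in>verts H1. \<forall>H2\<in>C. \<forall>v2\<in>verts H2.
        i < deg H1 v1 \<and> edge_view t H1 v1 i = edge_view t G v i \<and>
        i < deg H2 v2 \<and> edge_view t H2 v2 i = edge_view t G v i \<longrightarrow>
        (\<exists>H\<in>C. \<exists>w\<in>verts H. i < deg H w \<and> edge_view t H w i = edge_view t G v i \<and>
            nview t H w = nview t H1 v1 \<and>
            nview t H (nbr H w i) = nview t H2 (nbr H2 v2 i))) \<and>
    (\<forall>G\<in>C. \<forall>v\<in>verts G. \<forall>(Hs :: nat \<Rightarrow> ('v, 'l) pgraph) (ws :: nat \<Rightarrow> 'v).
        (\<forall>i<deg G v. Hs i \<in> C \<and> ws i \<in> verts (Hs i) \<and> nview (t - 1) (Hs i) (ws i) = nview (t - 1) G v) \<longrightarrow>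
        (\<exists>H\<in>C. \<exists>w\<in>verts H. nview (t - 1) H w = nview (t - 1) G v \<and>
            (\<forall>i<deg G v. edge_view t H w i = edge_view t (Hs i) (ws i) i)))"

section \<open>Algorithms\<close>

text \<open>A t-round algorithm on graphs with identifiers: maps the radius-t view
  (with identifiers as node labels) and a port number to the output at that port.\<close>
definition order_invariant :: "((nat, 'l) view \<Rightarrow> nat \<Rightarrow> 'o) \<Rightarrow> bool" where
  "order_invariant A \<longleftrightarrow>
     (\<forall>V (\<sigma> :: nat \<Rightarrow> nat). strict_mono_on (set1_view V) \<sigma> \<longrightarrow> A (map_view \<sigma> id V) = A V)"

definition solves_on :: "'o lcl_problem \<Rightarrow> nat \<Rightarrow> ((nat, 'l) view \<Rightarrow> nat \<Rightarrow> 'o) \<Rightarrow> nat \<Rightarrow>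
    ('v, 'l) pgraph \<Rightarrow> ('v \<Rightarrow> nat) \<Rightarrow> bool" where
  "solves_on P D A t G idf \<longleftrightarrow>
     (let out = (\<lambda>v i. A (pview t G idf v None) i) in
       (\<forall>v\<in>verts G. \<forall>i<deg G v. out v i \<in> outs P D) \<and>
       (\<forall>v\<in>verts G. \<forall>i<deg G v. {# out v i, out (nbr G v i) (backport G v i) #} \<in> edgec P D) \<and>
       (\<forall>v\<in>verts G. mset (map (out v) [0..<deg G v]) \<in> nodec P D))"

text \<open>Solving on G': every graph of C with unique identifiers from S.\<close>
definition solves_with_ids :: "'o lcl_problem \<Rightarrow> nat \<Rightarrow> ((nat, 'l) view \<Rightarrow> nat \<Rightarrow> 'o) \<Rightarrow> nat \<Rightarrow>
    ('v, 'l) pgraph set \<Rightarrow> nat set \<Rightarrow> bool" where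
  "solves_with_ids P D A t C S \<longleftrightarrow>
     (\<forall>G\<in>C. \<forall>idf. inj_on idf (verts G) \<and> idf ` verts G \<subseteq> S \<longrightarrow> solves_on P D A t G idf)"

end

theory Submission
  imports Defs
begin

text \<open>
  An order-invariant algorithm is a function of order types of labelled neighbourhoods.  To save one
  round, an edge \<open>e\<close> collects all outputs that a \<open>t\<close>-round algorithm gives at its endpoints over the
  realizations of the order type of \<open>N\<^sup>t(e)\<close>, and a node collects these sets over the realizations
  of the order type of \<open>N\<^sup>t\<^sup>-\<^sup>1(v)\<close>.  The constraints of the derived problem hold because any two
  extensions of an edge neighbourhood, and any family of extensions of a node neighbourhood, occur
  in one common graph: independence supplies the unlabelled graph, the girth bound makes all nodes of
  the neighbourhoods distinct and the extensions disjoint outside their common part, so the linear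
  orders of the identifiers amalgamate and extend to an injective assignment from \<open>S\<close>.  Conversely,
  in one extra round the endpoints of an edge can agree on a compatible pair of sets, ties being
  broken by the identifiers.
\<close>

section \<open>Views up to order equivalence\<close>

text \<open>Order-invariance is what allows simultaneous realizations despite unique identifiers.
  Two realizations of an edge neighbourhood may use one identifier at nodes that become different
  nodes of the common graph, so the identifiers cannot be kept; their order can, since linear orders
  that agree on the overlap of their domains have a common extension. The overlap must then be
  exactly the shared neighbourhood, and this explains the girth constant: the
  radius-\<open>t\<close> views of both ends of an edge together contain paths of up to
  \<open>2 * t + 2\<close> nodes, whose nodes are distinct if no cycle is shorter than that.
  Independence speaks of unlabelled views only, so identifiers have to be carried from one graph to
  another. If a view lists every node once, views of equal shape are matched label by label, and the
  matching carries them over.\<close>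

definition order_equiv :: "(nat, 'l) view \<Rightarrow> (nat, 'l) view \<Rightarrow> bool" where
  "order_equiv V W \<longleftrightarrow> (\<exists>\<sigma>. strict_mono_on (set1_view V) \<sigma> \<and> W = map_view \<sigma> id V)"

definition same_order :: "'v set \<Rightarrow> ('v \<Rightarrow> nat) \<Rightarrow> ('v \<Rightarrow> nat) \<Rightarrow> bool" where
  "same_order X f g \<longleftrightarrow> (\<forall>x\<in>X. \<forall>y\<in>X. f x < f y \<longleftrightarrow> g x < g y)"

lemma same_order_sym: "same_order X f g \<Longrightarrow> same_order X g f"
  by (auto simp: same_order_def)

lemma same_order_trans: "same_order X f g \<Longrightarrow> same_order X g h \<Longrightarrow> same_order X f h"
  by (auto simp: same_order_def)

lemma same_order_subset: "same_order X f g \<Longrightarrow> Y \<subseteq> X \<Longrightarrow> same_order Y f g"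
  by (auto simp: same_order_def)

lemma same_orderI:
  assumes "inj_on f X" and "\<And>x y. x \<in> X \<Longrightarrow> y \<in> X \<Longrightarrow> f x < f y \<Longrightarrow> g x < g y"
  shows "same_order X f g"
  unfolding same_order_def
proof (intro ballI iffI)
  fix x y assume xy: "x \<in> X" "y \<in> X" and "g x < g y"
  then have "\<not> f y < f x" "x \<noteq> y"
    using assms(2)[of y x] by auto
  then show "f x < f y"
    using inj_onD[OF assms(1), of x y] xy by linarith
qed (use assms in auto)

lemma same_order_inj_on:
  assumes "same_order X f g" "inj_on f X" shows "inj_on g X"
proof (rule inj_onI)
  fix x y assume "x \<in> X" "y \<in> X" "g x = g y"
  then have "\<not> f x < f y" "\<not> f y < f x"
    using assms(1) by (auto simp: same_order_def)
  then show "x = y"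
    using inj_onD[OF assms(2)] \<open>x \<in> X\<close> \<open>y \<in> X\<close> by simp
qed

lemma map_view_eq_iff:
  "map_view f id V = map_view g id V \<longleftrightarrow> (\<forall>x\<in>set1_view V. f x = g x)"
proof
  assume "\<forall>x\<in>set1_view V. f x = g x"
  then show "map_view f id V = map_view g id V"
    by (intro view.map_cong0) auto
next
  show "map_view f id V = map_view g id V \<Longrightarrow> \<forall>x\<in>set1_view V. f x = g x"
  proof (induction V)
    case (View a ls cs)
    have "f x = g x" if c: "c \<in> set cs" "p \<in> set_option c" "U \<in> Basic_BNFs.snds p"
        and x: "x \<in> set1_view U" for c p U x
    proof -
      obtain j where cj: "c = Some (j, U)"
        using c by (cases p) auto
      have "map_option (map_prod id (map_view f id)) c = map_option (map_prod id (map_view g id)) c"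
        using View.prems c(1) by (auto simp: id_def)
      then have "map_view f id U = map_view g id U"
        by (simp add: cj)
      then show ?thesis
        using View.IH[OF c] x by blast
    qed
    then show ?case
      using View.prems by auto
  qed
qed

text \<open>Reduces order types of views to a comparison of two identifier assignments on the same
  nodes. For the converse the relabelling is \<open>g\<close> after a choice of preimage under
  \<open>f\<close>; the choice is harmless because \<open>same_order\<close> gives equal
  \<open>g\<close>-values to equal \<open>f\<close>-values.\<close>

lemma order_equiv_map_iff:
  "order_equiv (map_view f id V) (map_view g id V) \<longleftrightarrow> same_order (set1_view V) f g"
proof
  assume "order_equiv (map_view f id V) (map_view g id V)"
  then obtain s where s: "strict_mono_on (f ` set1_view V) s"
      and "map_view g id V = map_view (s \<circ> f) id V"
    by (auto simp: order_equiv_def view.set_map view.map_comp)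
  then have g: "\<forall>x\<in>set1_view V. g x = s (f x)"
    by (simp add: map_view_eq_iff)
  show "same_order (set1_view V) f g"
    unfolding same_order_def
    using g strict_mono_on_less[OF s] by auto
next
  let ?X = "set1_view V"
  assume so: "same_order ?X f g"
  define s where "s = g \<circ> inv_into ?X f"
  have s: "s (f x) = g x" if "x \<in> ?X" for x
  proof -
    let ?y = "inv_into ?X f (f x)"
    have "?y \<in> ?X" "f ?y = f x"
      using that by (auto intro: inv_into_into f_inv_into_f)
    then have "g ?y = g x"
      using so that unfolding same_order_def by (metis less_irrefl linorder_neqE_nat)
    then show ?thesis by (simp add: s_def)
  qed
  have "strict_mono_on (f ` ?X) s"
    using so s by (auto simp: strict_mono_on_def same_order_def)
  moreover have "map_view g id V = map_view s id (map_view f id V)"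
    using s by (simp add: view.map_comp map_view_eq_iff)
  ultimately show "order_equiv (map_view f id V) (map_view g id V)"
    by (auto simp: order_equiv_def view.set_map)
qed

lemma order_equiv_refl: "order_equiv V V"
  unfolding order_equiv_def by (intro exI[of _ id]) (auto simp: strict_mono_on_def view.map_id)

lemma order_equiv_sym:
  assumes "order_equiv V W" shows "order_equiv W V"
proof -
  obtain s where s: "strict_mono_on (set1_view V) s" "W = map_view s id V"
    using assms by (auto simp: order_equiv_def)
  have "same_order (set1_view V) s id"
    using strict_mono_on_less[OF s(1)] by (auto simp: same_order_def)
  then have "order_equiv (map_view s id V) (map_view id id V)"
    by (simp only: order_equiv_map_iff)
  then show ?thesis by (simp add: s view.map_id)
qed

lemma order_equiv_trans:
  assumes "order_equiv U V" "order_equiv V W" shows "order_equiv U W"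
proof -
  obtain s where s: "strict_mono_on (set1_view U) s" "V = map_view s id U"
    using assms by (auto simp: order_equiv_def)
  obtain r where r: "strict_mono_on (set1_view V) r" "W = map_view r id V"
    using assms by (auto simp: order_equiv_def)
  have "strict_mono_on (set1_view U) (r \<circ> s)"
    using s r by (auto simp: strict_mono_on_def view.set_map)
  then show ?thesis
    using s r by (auto simp: order_equiv_def view.map_comp intro!: exI[of _ "r \<circ> s"])
qed

lemma order_equiv_shape:
  "order_equiv V W \<Longrightarrow> map_view (\<lambda>_. ()) id V = map_view (\<lambda>_. ()) id W"
  by (auto simp: order_equiv_def view.map_comp comp_def id_def)

text \<open>An algorithm is a function on all views, while the constructions below give outputs for
  realizations only. A view of a realized order type receives the value of a chosen representative;
  any other view gets \<open>undefined\<close>, which the correctness conditions never inspect in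
  the applications.\<close>

lemma order_invariant_extension:
  fixes vw :: "'r \<Rightarrow> (nat, 'l) view" and F :: "'r \<Rightarrow> nat \<Rightarrow> 'x"
  assumes "\<And>r s. r \<in> R \<Longrightarrow> s \<in> R \<Longrightarrow> order_equiv (vw r) (vw s) \<Longrightarrow> F r = F s"
  obtains A where "order_invariant A" "\<And>r. r \<in> R \<Longrightarrow> A (vw r) = F r"
proof
  define A where "A V = (if \<exists>r\<in>R. order_equiv V (vw r)
    then F (SOME r. r \<in> R \<and> order_equiv V (vw r)) else undefined)" for V
  have *: "order_equiv V (vw r) \<longleftrightarrow> order_equiv W (vw r)" if "order_equiv V W" for V W r
    using that order_equiv_sym order_equiv_trans by blast
  have "A (map_view s id V) = A V" if "strict_mono_on (set1_view V) s" for V s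
  proof -
    have "order_equiv V (map_view s id V)"
      using that by (auto simp: order_equiv_def)
    from *[OF this] show ?thesis
      by (simp add: A_def)
  qed
  then show "order_invariant A"
    by (simp add: order_invariant_def)
  fix r assume r: "r \<in> R"
  let ?s = "SOME s. s \<in> R \<and> order_equiv (vw r) (vw s)"
  have ex: "\<exists>s. s \<in> R \<and> order_equiv (vw r) (vw s)"
    using r order_equiv_refl by blast
  have "?s \<in> R \<and> order_equiv (vw r) (vw ?s)"
    using ex by (rule someI_ex)
  then show "A (vw r) = F r"
    using assms[of r ?s] r ex by (auto simp: A_def)
qed

section \<open>Relabelling views without repeated labels\<close>

text \<open>A list rather than \<open>set1_view\<close>, so that repetitions show: with every node
  as its own label, \<open>distinct\<close> says that the exploration meets no node twice. The
  nested maps are the shape required for recursion through lists, options and pairs.\<close>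

primrec labels :: "('a, 'l) view \<Rightarrow> 'a list" where
  "labels (View a ls cs) =
     a # concat (map (case_option [] snd) (map (map_option (map_prod id labels)) cs))"

lemma set_labels: "set (labels V) = set1_view V"
proof (induction V)
  case (View a ls cs)
  have "set (case_option [] snd (map_option (map_prod id labels) c)) =
      (\<Union>p\<in>set_option c. \<Union>U\<in>Basic_BNFs.snds p. set1_view U)" if "c \<in> set cs" for c
    using View[OF that] by (cases c) (auto simp: prod_set_defs)
  then show ?case
    by auto
qed

lemma labels_map_view: "labels (map_view f g V) = map f (labels V)"
proof (induction V)
  case (View a ls cs)
  have "case_option [] snd (map_option (map_prod id labels)
          (map_option (map_prod id (map_view f g)) c)) =
      map f (case_option [] snd (map_option (map_prod id labels) c))" if "c \<in> set cs" for c
    using View[OF that] by (cases c) (auto simp: prod_set_defs)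
  then show ?case
    by (auto simp: map_concat intro!: arg_cong[of _ _ concat])
qed

text \<open>Equal shapes make corresponding children carry equally many labels, so the equation
  between the flat label lists splits into one equation per child.\<close>

lemma map_view_eqI:
  fixes V :: "('a, 'l) view" and W :: "('b, 'l) view"
  assumes "map_view (\<lambda>_. ()) id V = map_view (\<lambda>_. ()) id W"
    and "map r (labels V) = labels W"
  shows "map_view r id V = W"
  using assms
proof (induction V arbitrary: W)
  case (View a ls cs)
  obtain b ms ds where W: "W = View b ms ds" by (cases W)
  let ?sh = "map_option (map_prod id (map_view (\<lambda>_. ()) id))"
  define lv where "lv c = case_option [] snd (map_option (map_prod id labels) c)"
    for c :: "(nat \<times> ('a, 'l) view) option"
  define lv' where "lv' c = case_option [] snd (map_option (map_prod id labels) c)"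
    for c :: "(nat \<times> ('b, 'l) view) option"
  have sh: "map ?sh cs = map ?sh ds" and ls: "ls = ms"
    using View.prems(1) by (auto simp: W id_def)
  have len: "length cs = length ds"
    using sh map_eq_imp_length_eq by blast
  have shk: "?sh (cs ! k) = ?sh (ds ! k)" if "k < length cs" for k
    using arg_cong[OF sh, of "\<lambda>xs. xs ! k"] that len by simp
  have lenlab: "length (labels U) = length (labels U')"
    if "map_view (\<lambda>_. ()) id U = map_view (\<lambda>_. ()) id U'"
    for U :: "('a, 'l) view" and U' :: "('b, 'l) view"
    using arg_cong[OF that, of "\<lambda>x. length (labels x)"] by (simp add: labels_map_view)
  have lenk: "length (map r (lv (cs ! k))) = length (lv' (ds ! k))" if "k < length cs" for k
    using shk[OF that] lenlab by (cases "cs ! k"; cases "ds ! k") (auto simp: lv_def lv'_def)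
  have "r a # concat (map (\<lambda>c. map r (lv c)) cs) = b # concat (map lv' ds)"
    using View.prems(2) unfolding W labels.simps list.map map_concat map_map comp_def lv_def lv'_def .
  then have "concat (map (\<lambda>c. map r (lv c)) cs) = concat (map lv' ds)" and a: "r a = b"
    by (simp_all only: list.inject)
  moreover have "\<forall>(x, y)\<in>set (zip (map (\<lambda>c. map r (lv c)) cs) (map lv' ds)). length x = length y"
    using lenk len by (auto simp: set_zip)
  ultimately have "map (\<lambda>c. map r (lv c)) cs = map lv' ds"
    using len by (subst (asm) concat_eq_concat_iff) auto
  then have lvk: "map r (lv (cs ! k)) = lv' (ds ! k)" if "k < length cs" for k
    using that len by (metis (no_types, lifting) nth_map)
  have "map_option (map_prod id (map_view r id)) (cs ! k) = ds ! k" if k: "k < length cs" for k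
  proof (cases "cs ! k")
    case None
    then show ?thesis using shk[OF k] by simp
  next
    case (Some p)
    then obtain j U where c: "cs ! k = Some (j, U)" by (cases p) auto
    then obtain U' where d: "ds ! k = Some (j, U')"
        and "map_view (\<lambda>_. ()) id U = map_view (\<lambda>_. ()) id U'"
      using shk[OF k] by (cases "ds ! k") auto
    moreover have "map r (labels U) = labels U'"
      using lvk[OF k] c d by (simp add: lv_def lv'_def)
    ultimately have "map_view r id U = U'"
      using View.IH[of "cs ! k" "(j, U)" U U'] nth_mem[OF k] c by (simp add: prod_set_defs id_def)
    then show ?thesis using c d by simp
  qed
  then have "map (map_option (map_prod id (map_view r id))) cs = ds"
    using len by (intro nth_equalityI) auto
  then show ?case
    by (simp add: W ls a id_def)
qed

text \<open>Labels are matched by position. Distinct labels in \<open>V\<close> make the matching a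
  function, distinct labels in \<open>W\<close> make it injective.\<close>

lemma relabel_view:
  fixes V :: "('a, 'l) view" and W :: "('b, 'l) view"
  assumes "map_view (\<lambda>_. ()) id V = map_view (\<lambda>_. ()) id W"
    and "distinct (labels V)" "distinct (labels W)"
  obtains r where "map_view r id V = W" "inj_on r (set1_view V)"
proof
  define r where "r = the \<circ> map_of (zip (labels V) (labels W))"
  have len: "length (labels V) = length (labels W)"
    using arg_cong[OF assms(1), of "\<lambda>x. length (labels x)"] by (simp add: labels_map_view)
  have m: "map r (labels V) = labels W"
    using len assms(2) by (auto intro!: nth_equalityI simp: r_def map_of_zip_nth)
  show "map_view r id V = W"
    by (rule map_view_eqI[OF assms(1) m])
  show "inj_on r (set1_view V)"
    using m assms(3) by (metis distinct_map set_labels)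
qed

section \<open>Amalgamating orders\<close>

text \<open>Each element goes into the gap between consecutive elements of \<open>X1 \<inter> X2\<close> that it occupies in its
  own order; within a gap, \<open>X1\<close> precedes \<open>X2\<close>.  The witness \<open>f\<close> encodes the lexicographic order of
  (gap \<open>c\<close>, \<open>tag\<close>, own rank).\<close>
lemma same_order_amalgam:
  fixes r1 r2 :: "'v \<Rightarrow> nat"
  assumes fin: "finite X1" "finite X2" and inj: "inj_on r1 X1" "inj_on r2 X2"
    and so: "same_order (X1 \<inter> X2) r1 r2"
  obtains f where "inj_on f (X1 \<union> X2)" "same_order X1 r1 f" "same_order X2 r2 f"
proof -
  define B where "B = X1 \<inter> X2"
  define r where "r x = (if x \<in> X1 then r1 x else r2 x)" for x
  define c where "c x = (if x \<in> X1 then card {b\<in>B. r1 b \<le> r1 x} else card {b\<in>B. r2 b \<le> r2 x})" for x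
  define tag :: "'v \<Rightarrow> nat" where
    "tag x = (if x \<in> B then 0 else if x \<in> X1 then 1 else 2)" for x
  define M where "M = Suc (Max (insert 0 (r ` (X1 \<union> X2))))"
  define f where "f x = (3 * c x + tag x) * M + r x" for x
  have finB: "finite B"
    using fin by (simp add: B_def)
  have rM: "r x < M" if "x \<in> X1 \<union> X2" for x
    unfolding M_def less_Suc_eq_le using that fin by (intro Max_ge) auto
  have lt: "a * M + p < b * M + q" if "a < b" "p < M" for a b p q
  proof -
    have "a * M + p < Suc a * M" using that(2) by simp
    also have "\<dots> \<le> b * M" using that(1) by (intro mult_le_mono1) simp
    finally show ?thesis by simp
  qed
  have tag2: "tag x \<le> 2" for x by (simp add: tag_def)
  have fless: "f x < f y" if "x \<in> X1 \<union> X2" and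
    "c x < c y \<or> c x = c y \<and> (tag x < tag y \<or> tag x = tag y \<and> r x < r y)" for x y
  proof -
    have "3 * c x + tag x < 3 * c y + tag y \<or> 3 * c x + tag x = 3 * c y + tag y \<and> r x < r y"
      using that(2) tag2[of x] tag2[of y] by linarith
    then show ?thesis
      unfolding f_def using lt[OF _ rM[OF that(1)]] by auto
  qed
  have c2: "c x = card {b\<in>B. r2 b \<le> r2 x}" if "x \<in> X2" for x
  proof (cases "x \<in> X1")
    case True
    then have "r1 b \<le> r1 x \<longleftrightarrow> r2 b \<le> r2 x" if "b \<in> B" for b
      using \<open>x \<in> X2\<close> so that by (auto simp: B_def same_order_def not_less[symmetric])
    then have "{b\<in>B. r1 b \<le> r1 x} = {b\<in>B. r2 b \<le> r2 x}"
      by blast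
    then show ?thesis using True by (simp add: c_def)
  qed (simp add: c_def)
  \<comment> \<open>The count uses \<open>\<le>\<close>, so an element of \<open>B\<close> opens its
    own gap. A larger \<open>y\<close> in \<open>B\<close> therefore raises the count; with equal
    counts \<open>y\<close> lies outside \<open>B\<close>, and within one of the two sets its tag is
    then not below that of \<open>x\<close>.\<close>
  have cnt: "card {b\<in>B. s b \<le> s x} < card {b\<in>B. s b \<le> s y} \<or>
      card {b\<in>B. s b \<le> s x} = card {b\<in>B. s b \<le> s y} \<and> y \<notin> B"
    if "s x < s y" for s :: "'v \<Rightarrow> nat" and x y
  proof -
    have sub: "{b\<in>B. s b \<le> s x} \<subseteq> {b\<in>B. s b \<le> s y}" using that by auto
    show ?thesis
    proof (cases "y \<in> B")
      case True
      then have "y \<in> {b\<in>B. s b \<le> s y} - {b\<in>B. s b \<le> s x}" using that by simp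
      then have "{b\<in>B. s b \<le> s x} \<subset> {b\<in>B. s b \<le> s y}" using sub by blast
      then show ?thesis using finB by (simp add: psubset_card_mono)
    next
      case False
      then show ?thesis using card_mono[OF _ sub] finB by (auto simp: le_less)
    qed
  qed
  have l1: "f x < f y" if "x \<in> X1" "y \<in> X1" "r1 x < r1 y" for x y
    using that cnt[of r1 x y] by (intro fless) (auto simp: c_def tag_def r_def)
  have l2: "f x < f y" if "x \<in> X2" "y \<in> X2" "r2 x < r2 y" for x y
  proof (intro fless)
    show "c x < c y \<or> c x = c y \<and> (tag x < tag y \<or> tag x = tag y \<and> r x < r y)"
      using that cnt[of r2 x y] c2[of x] c2[of y] by (auto simp: tag_def r_def B_def)
  qed (use that in auto)
  have so1: "same_order X1 r1 f"
    using inj(1) l1 by (rule same_orderI)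
  have so2: "same_order X2 r2 f"
    using inj(2) l2 by (rule same_orderI)
  \<comment> \<open>Tag 2 belongs to \<open>X2 - X1\<close> only, so the block numbers
    \<open>3 * c + tag\<close> differ modulo 3.\<close>
  have cross: "f x \<noteq> f y" if "x \<in> X1" "y \<in> X2" "y \<notin> X1" for x y
  proof -
    have "tag x \<noteq> tag y" using that by (auto simp: tag_def B_def)
    then have "3 * c x + tag x \<noteq> 3 * c y + tag y"
      using tag2[of x] tag2[of y] by presburger
    then show ?thesis
      unfolding f_def using lt[of "3 * c x + tag x" "3 * c y + tag y" "r x" "r y"]
        lt[of "3 * c y + tag y" "3 * c x + tag x" "r y" "r x"] rM[of x] rM[of y] that
      by (cases "3 * c x + tag x < 3 * c y + tag y") auto
  qed
  have i1: "inj_on f X1" and i2: "inj_on f X2"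
    using so1 so2 inj same_order_inj_on by blast+
  have "inj_on f (X1 \<union> X2)"
  proof (rule inj_onI)
    fix x y assume xy: "x \<in> X1 \<union> X2" "y \<in> X1 \<union> X2" "f x = f y"
    consider "x \<in> X1" "y \<in> X1" | "x \<in> X2" "y \<in> X2"
      | "x \<in> X1" "y \<in> X2" "y \<notin> X1" | "y \<in> X1" "x \<in> X2" "x \<notin> X1"
      using xy by blast
    then show "x = y"
    proof cases
      case 1 then show ?thesis using xy(3) inj_onD[OF i1] by simp
    next
      case 2 then show ?thesis using xy(3) inj_onD[OF i2] by simp
    next
      case 3 then show ?thesis using xy(3) cross by simp
    next
      case 4 then show ?thesis using xy(3) cross[of y x] by simp
    qed
  qed
  then show thesis using that so1 so2 by blast
qed

text \<open>Adds the sets one at a time. A new set meets the union of the earlier ones inside the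
  core \<open>Y\<close>, where the order built so far agrees with \<open>r 0\<close> and hence with
  the order of the new set.\<close>

lemma same_order_star_amalgam:
  fixes r :: "nat \<Rightarrow> 'v \<Rightarrow> nat"
  assumes fin: "\<And>i. i < d \<Longrightarrow> finite (X i)" and inj: "\<And>i. i < d \<Longrightarrow> inj_on (r i) (X i)"
    and core: "\<And>i j. i < d \<Longrightarrow> j < d \<Longrightarrow> i \<noteq> j \<Longrightarrow> X i \<inter> X j = Y"
    and so: "\<And>i j. i < d \<Longrightarrow> j < d \<Longrightarrow> same_order Y (r i) (r j)"
  obtains f where "inj_on f (\<Union>i<d. X i)" "\<And>i. i < d \<Longrightarrow> same_order (X i) (r i) f"
proof -
  have "\<exists>f. inj_on f (\<Union>i<m. X i) \<and> (\<forall>i<m. same_order (X i) (r i) f)" if "m \<le> d" for m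
    using that
  proof (induction m)
    case (Suc m)
    then obtain f where f: "inj_on f (\<Union>i<m. X i)" "\<forall>i<m. same_order (X i) (r i) f" by auto
    let ?U = "\<Union>i<m. X i"
    have "same_order (?U \<inter> X m) f (r m)"
    \<comment> \<open>With no earlier set the union is empty. Otherwise there are two distinct
      indices, and only then does \<open>core\<close> place \<open>Y\<close> inside
      \<open>X 0\<close>.\<close>
    proof (cases "m = 0")
      case False
      have "?U \<inter> X m \<subseteq> Y" 
      proof
        fix x assume "x \<in> ?U \<inter> X m"
        then obtain i where "i < m" "x \<in> X i \<inter> X m" by auto
        then show "x \<in> Y" using core[of i m] Suc.prems by simp
      qed
      have "Y \<subseteq> X 0" using core[of 0 m] False Suc.prems by auto
      have "same_order (X 0) (r 0) f" and r0m: "same_order Y (r 0) (r m)"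
        using f(2) so[of 0 m] False Suc.prems by auto
      then have "same_order Y f (r 0)"
        using same_order_sym[OF same_order_subset[OF _ \<open>Y \<subseteq> X 0\<close>]] by simp
      then have "same_order Y f (r m)"
        using r0m by (rule same_order_trans)
      then show ?thesis using \<open>?U \<inter> X m \<subseteq> Y\<close> by (rule same_order_subset)
    qed (simp add: same_order_def)
    moreover have "finite ?U" "finite (X m)" "inj_on (r m) (X m)"
      using fin inj Suc.prems by auto
    ultimately obtain g where g: "inj_on g (?U \<union> X m)" "same_order ?U f g" "same_order (X m) (r m) g"
      using same_order_amalgam[of ?U "X m" f "r m"] f(1) by blast
    have "same_order (X i) (r i) g" if "i < Suc m" for i
    proof (cases "i = m")
      case False
      then have "i < m" using that by simp
      then have "X i \<subseteq> ?U" by blast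
      then show ?thesis
        using same_order_trans[OF _ same_order_subset[OF g(2)]] f(2) \<open>i < m\<close> by simp
    qed (use g in simp)
    moreover have "inj_on g (\<Union>i<Suc m. X i)"
      using g(1) by (simp add: lessThan_Suc Un_commute)
    ultimately show ?case by blast
  qed simp
  then show thesis using that by blast
qed

text \<open>The other nodes are placed above all values on \<open>X\<close>; then every node gets
  the element of \<open>S\<close> with the same rank, which exists because there are at most
  \<open>card S\<close> ranks.\<close>

lemma same_order_extend_into:
  fixes f :: "'v \<Rightarrow> nat" and S :: "nat set"
  assumes "finite V" "X \<subseteq> V" "inj_on f X" "finite S" "card V \<le> card S"
  obtains g where "inj_on g V" "g ` V \<subseteq> S" "same_order X f g"
proof -
  obtain e :: "'v \<Rightarrow> nat" where e: "inj_on e V"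
    using finite_imp_inj_to_nat_seg[OF assms(1)] by auto
  define M where "M = Suc (Max (insert 0 (f ` X)))"
  define h where "h x = (if x \<in> X then f x else M + e x)" for x
  have fM: "f x < M" if "x \<in> X" for x
    unfolding M_def less_Suc_eq_le using that assms(1,2) finite_subset by (intro Max_ge) auto
  have h: "inj_on h V"
  proof (rule inj_onI)
    fix x y assume "x \<in> V" "y \<in> V" "h x = h y"
    then show "x = y"
      using fM[of x] fM[of y] assms(3) e
      by (auto simp: h_def inj_on_def split: if_splits)
  qed
  define rk where "rk x = card {y\<in>V. h y < h x}" for x
  have rk_less: "rk x < card V" if "x \<in> V" for x
    unfolding rk_def using that assms(1) by (intro psubset_card_mono) auto
  have rk_mono: "rk x < rk y" if "x \<in> V" "h x < h y" for x y
    unfolding rk_def using that assms(1) by (intro psubset_card_mono) auto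
  define g where "g x = sorted_list_of_set S ! rk x" for x
  have len: "length (sorted_list_of_set S) = card S" by simp
  have g_mono: "g x < g y" if "x \<in> V" "y \<in> V" "h x < h y" for x y
    unfolding g_def using rk_mono[OF that(1,3)] rk_less[OF that(2)] assms(5) len
    by (intro sorted_wrt_nth_less[OF strict_sorted_list_of_set]) auto
  show thesis
  proof
    show "inj_on g V"
      using same_orderI[OF h g_mono] h by (rule same_order_inj_on)
    show "g ` V \<subseteq> S"
    proof
      fix z assume "z \<in> g ` V"
      then obtain x where "x \<in> V" "z = g x" by auto
      then have "z \<in> set (sorted_list_of_set S)"
        using rk_less[of x] assms(5) by (auto simp: g_def)
      then show "z \<in> S" using assms(4) by simp
    qed
    show "same_order X f g"
      using assms(3) by (rule same_orderI) (use g_mono assms(2) in \<open>auto simp: h_def subset_iff\<close>)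
  qed
qed

section \<open>Views of port-numbered graphs\<close>

lemma pview_map: "map_view f id (pview k G a v ex) = pview k G (f \<circ> a) v ex"
  by (induction k arbitrary: v ex) auto

lemma pview_eq_map: "pview k G a v ex = map_view a id (pview k G (\<lambda>x. x) v ex)"
  by (simp add: pview_map comp_def)

lemma map_upt_eq_iff:
  "map f [0..<m] = map g [0..<n] \<longleftrightarrow> m = n \<and> (\<forall>i<m. f i = g i)"
proof
  assume eq: "map f [0..<m] = map g [0..<n]"
  then have "m = n"
    using map_eq_imp_length_eq by fastforce
  then show "m = n \<and> (\<forall>i<m. f i = g i)"
    using eq by simp
qed simp

lemma pview_0_eq_iff:
  "pview 0 G a v ex = pview 0 G' a' v' ex' \<longleftrightarrow>
     a v = a' v' \<and> deg G v = deg G' v' \<and> (\<forall>i<deg G v. inp G v i = inp G' v' i)"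
  by (auto simp: map_upt_eq_iff)

lemma pview_Suc_eq_iff:
  "pview (Suc k) G a v ex = pview (Suc k) G' a' v' ex \<longleftrightarrow>
     a v = a' v' \<and> deg G v = deg G' v' \<and> (\<forall>i<deg G v. inp G v i = inp G' v' i) \<and>
     (\<forall>i<deg G v. ex \<noteq> Some i \<longrightarrow> backport G v i = backport G' v' i \<and>
        pview k G a (nbr G v i) (Some (backport G v i)) =
        pview k G' a' (nbr G' v' i) (Some (backport G v i)))"
  by (auto simp: map_upt_eq_iff)

lemma pview_eq_deg:
  "pview k G a v ex = pview k G' a' v' ex \<Longrightarrow> deg G v = deg G' v'"
  by (cases k) (auto simp: pview_0_eq_iff pview_Suc_eq_iff simp del: pview.simps)

lemma pview_eq_root: "pview k G a v ex = pview k G' a' v' ex \<Longrightarrow> a v = a' v'"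
  by (cases k) auto

lemma pview_eq_le:
  "pview (Suc k) G a v ex = pview (Suc k) G' a' v' ex \<Longrightarrow> pview k G a v ex = pview k G' a' v' ex"
proof (induction k arbitrary: v v' ex)
  case 0
  then show ?case unfolding pview_0_eq_iff pview_Suc_eq_iff by blast
next
  case (Suc k)
  then show ?case
    unfolding pview_Suc_eq_iff[of "Suc k" G a v] pview_Suc_eq_iff[of k G a v] by blast
qed

lemma pview_eq_exclude:
  assumes "pview k G a v None = pview k G' a' v' None"
  shows "pview k G a v (Some i) = pview k G' a' v' (Some i)"
proof (cases k)
  case (Suc m)
  then show ?thesis
    using assms unfolding Suc pview_Suc_eq_iff by blast
qed (use assms in simp)

text \<open>With every node as its own label, the labels are the explored nodes, and the view under
  any identifiers is a relabelling of this one.\<close>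

definition vis :: "nat \<Rightarrow> ('v, 'l) pgraph \<Rightarrow> 'v \<Rightarrow> nat option \<Rightarrow> 'v set" where
  "vis k G v ex = set1_view (pview k G (\<lambda>x. x) v ex)"

lemma vis_0 [simp]: "vis 0 G v ex = {v}"
  by (simp add: vis_def)

lemma vis_Suc:
  "vis (Suc k) G v ex = insert v (\<Union>i\<in>{i. i < deg G v \<and> ex \<noteq> Some i}.
     vis k G (nbr G v i) (Some (backport G v i)))"
  by (auto simp: vis_def prod_set_defs split: if_splits)

lemma root_in_vis: "v \<in> vis k G v ex"
  by (cases k) (auto simp: vis_Suc)

lemma vis_le_Suc: "vis k G v ex \<subseteq> vis (Suc k) G v ex"
proof (induction k arbitrary: v ex)
  case (Suc k)
  show ?case
    unfolding vis_Suc[of k G v] vis_Suc[of "Suc k" G v] by (intro insert_mono UN_mono Suc.IH) simp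
qed (simp add: root_in_vis)

lemma vis_exclude: "vis k G v ex \<subseteq> vis k G v None"
  by (cases k) (auto simp: vis_Suc)

lemma finite_vis: "finite (vis k G v ex)"
  by (metis vis_def List.finite_set set_labels)

lemma set1_pview: "set1_view (pview k G a v ex) = a ` vis k G v ex"
  by (subst pview_eq_map) (simp add: vis_def view.set_map)

lemma order_equiv_pview_iff:
  "order_equiv (pview k G f v ex) (pview k G g v ex) \<longleftrightarrow> same_order (vis k G v ex) f g"
  unfolding vis_def order_equiv_map_iff[symmetric] by (simp add: pview_map comp_def)

section \<open>Edge neighbourhoods between consecutive node neighbourhoods\<close>

definition join_views :: "('a, 'l) view \<Rightarrow> nat \<Rightarrow> ('a, 'l) view \<Rightarrow> ('a, 'l) view" where
  "join_views V j U = (case V of View a ls cs \<Rightarrow> View a ls (cs @ [Some (j, U)]))"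

lemma join_views_eq_iff [simp]:
  "join_views V j U = join_views V' j' U' \<longleftrightarrow> V = V' \<and> j = j' \<and> U = U'"
  by (cases V; cases V') (auto simp: join_views_def)

lemma map_view_join_views [simp]:
  "map_view f g (join_views V j U) = join_views (map_view f g V) j (map_view f g U)"
  by (cases V) (simp add: join_views_def)

lemma set1_join_views [simp]: "set1_view (join_views V j U) = set1_view V \<union> set1_view U"
  by (cases V) (auto simp: join_views_def prod_set_defs)

lemma labels_join_views [simp]: "labels (join_views V j U) = labels V @ labels U"
  by (cases V) (simp add: join_views_def)

text \<open>The edge neighbourhood \<open>N\<^sup>k\<^sup>+\<^sup>1(e)\<close> with node labels \<open>a\<close>, packed into a single view so
  that \<^const>\<open>order_equiv\<close> and \<^const>\<open>labels\<close> apply to it.\<close>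
definition epview :: "nat \<Rightarrow> ('v, 'l) pgraph \<Rightarrow> ('v \<Rightarrow> 'a) \<Rightarrow> 'v \<Rightarrow> nat \<Rightarrow> ('a, 'l) view" where
  "epview k G a v i = join_views (pview k G a v (Some i)) (backport G v i)
     (pview k G a (nbr G v i) (Some (backport G v i)))"

definition evis :: "nat \<Rightarrow> ('v, 'l) pgraph \<Rightarrow> 'v \<Rightarrow> nat \<Rightarrow> 'v set" where
  "evis k G v i = vis k G v (Some i) \<union> vis k G (nbr G v i) (Some (backport G v i))"

lemma epview_map: "map_view f id (epview k G a v i) = epview k G (f \<circ> a) v i"
  by (simp add: epview_def pview_map)

lemma set1_epview: "set1_view (epview k G a v i) = a ` evis k G v i"
  by (simp add: epview_def evis_def set1_pview image_Un)

lemma order_equiv_epview_iff: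
  "order_equiv (epview k G f v i) (epview k G g v i) \<longleftrightarrow> same_order (evis k G v i) f g"
  using order_equiv_map_iff[of f "epview k G (\<lambda>x. x) v i" g]
  by (simp add: epview_map comp_def set1_epview)

lemma edge_view_eq_iff:
  "edge_view t G v i = edge_view t G' v' i \<longleftrightarrow>
     epview (t - 1) G (\<lambda>_. ()) v i = epview (t - 1) G' (\<lambda>_. ()) v' i"
  by (auto simp: edge_view_def epview_def)

lemma evis_subset_vis: "i < deg G v \<Longrightarrow> evis k G v i \<subseteq> vis (Suc k) G v None"
  using vis_le_Suc[of k G v "Some i"] vis_exclude[of "Suc k" G v "Some i"]
  by (auto simp: evis_def vis_Suc)

text \<open>Behind port \<open>i\<close> the ball reaches only depth \<open>k - 1\<close> from the
  neighbour, which the other half of the edge neighbourhood covers.\<close>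

lemma vis_subset_evis: "vis k G v None \<subseteq> evis k G v i"
proof (cases k)
  case (Suc m)
  show ?thesis
  proof
    fix x assume "x \<in> vis k G v None"
    then consider "x = v"
      | l where "l < deg G v" "x \<in> vis m G (nbr G v l) (Some (backport G v l))"
      by (auto simp: Suc vis_Suc)
    then show "x \<in> evis k G v i"
    proof cases
      case 1
      then show ?thesis by (simp add: evis_def root_in_vis)
    next
      case 2
      then show ?thesis
        using vis_le_Suc[of m G "nbr G v i" "Some (backport G v i)"]
        by (cases "l = i") (auto simp: evis_def Suc vis_Suc[of m G v])
    qed
  qed
qed (simp add: evis_def)

text \<open>First half of a sandwich: the view of radius \<open>Suc k\<close> determines the edge
  neighbourhood, which in turn determines the view of radius \<open>k\<close>. Both the gain and the
  loss of a round rest on it.\<close>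

lemma epview_eq_of_pview_eq:
  assumes "pview (Suc k) G a v None = pview (Suc k) G' a' v' None" "i < deg G v"
  shows "epview k G a v i = epview k G' a' v' i"
proof -
  have "pview k G a v (Some i) = pview k G' a' v' (Some i)"
    using assms(1) by (rule pview_eq_le[OF pview_eq_exclude])
  moreover have "backport G v i = backport G' v' i \<and>
      pview k G a (nbr G v i) (Some (backport G v i)) =
      pview k G' a' (nbr G' v' i) (Some (backport G v i))"
    using assms unfolding pview_Suc_eq_iff by blast
  ultimately show ?thesis
    by (auto simp: epview_def)
qed

lemma pview_eq_of_epview_eq:
  assumes "epview k G a v i = epview k G' a' v' i"
  shows "pview k G a v None = pview k G' a' v' None"
proof (cases k)
  case 0
  then show ?thesis using assms by (simp add: epview_def)
next
  case (Suc m)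
  have bp: "backport G v i = backport G' v' i"
    and v: "pview (Suc m) G a v (Some i) = pview (Suc m) G' a' v' (Some i)"
    and "pview (Suc m) G a (nbr G v i) (Some (backport G v i)) =
      pview (Suc m) G' a' (nbr G' v' i) (Some (backport G v i))"
    using assms by (auto simp: epview_def Suc simp del: pview.simps)
  from pview_eq_le[OF this(3)] bp v show ?thesis
    unfolding Suc pview_Suc_eq_iff by auto
qed

text \<open>The order-preserving relabelling is absorbed into the identifiers as
  \<open>s \<circ> a\<close>, which turns order equivalence into an equality of views.\<close>

lemma order_equiv_epview:
  assumes "order_equiv (pview (Suc k) G a v None) (pview (Suc k) G' a' v' None)" "i < deg G v"
  shows "order_equiv (epview k G a v i) (epview k G' a' v' i)"
proof -
  obtain s where s: "strict_mono_on (a ` vis (Suc k) G v None) s"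
      and "pview (Suc k) G' a' v' None = pview (Suc k) G (s \<circ> a) v None"
    using assms(1) by (auto simp: order_equiv_def pview_map set1_pview simp del: pview.simps)
  then have "epview k G' a' v' i = map_view s id (epview k G a v i)"
    using epview_eq_of_pview_eq[of k G "s \<circ> a" v G' a' v' i] assms(2)
    by (simp add: epview_map del: pview.simps)
  moreover have "strict_mono_on (a ` evis k G v i) s"
    using s evis_subset_vis[OF assms(2), of k] by (auto simp: strict_mono_on_def)
  ultimately show ?thesis
    by (auto simp: order_equiv_def set1_epview)
qed

lemma order_equiv_pview:
  assumes "order_equiv (epview k G a v i) (epview k G' a' v' i)"
  shows "order_equiv (pview k G a v None) (pview k G' a' v' None)"
proof -
  obtain s where s: "strict_mono_on (a ` evis k G v i) s"
      and "epview k G' a' v' i = epview k G (s \<circ> a) v i"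
    using assms(1) by (auto simp: order_equiv_def epview_map set1_epview)
  then have "pview k G' a' v' None = map_view s id (pview k G a v None)"
    using pview_eq_of_epview_eq[of k G "s \<circ> a" v i G' a' v'] by (simp add: pview_map)
  moreover have "strict_mono_on (a ` vis k G v None) s"
    using s vis_subset_evis[of k G v i] by (auto simp: strict_mono_on_def)
  ultimately show ?thesis
    by (auto simp: order_equiv_def set1_pview)
qed

lemma nview_eq_of_order_equiv:
  assumes "order_equiv (pview k G a v None) (pview k G' a' v' None)"
  shows "nview k G v = nview k G' v'"
  using order_equiv_shape[OF assms] by (simp add: nview_def pview_map comp_def)

lemma order_equiv_deg:
  assumes "order_equiv (pview k G a v None) (pview k G' a' v' None)"
  shows "deg G v = deg G' v'"
  using nview_eq_of_order_equiv[OF assms] unfolding nview_def by (rule pview_eq_deg)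

lemma order_equiv_backport:
  assumes "order_equiv (epview k G a v i) (epview k G' a' v' i)"
  shows "backport G v i = backport G' v' i"
  using order_equiv_shape[OF assms] by (simp add: epview_def)

lemma distinct_concat_map_upt:
  assumes "\<And>i. i < n \<Longrightarrow> distinct (f i)"
    and "\<And>i j. i < n \<Longrightarrow> j < n \<Longrightarrow> i \<noteq> j \<Longrightarrow> set (f i) \<inter> set (f j) = {}"
  shows "distinct (concat (map f [0..<n]))"
  using assms
proof (induction n)
  case (Suc n)
  have "x \<notin> set (f n)" if "i < n" "x \<in> set (f i)" for i x
    using Suc.prems(2)[of i n] that by auto
  moreover have "distinct (concat (map f [0..<n]))" "distinct (f n)"
    using Suc by simp_all
  ultimately show ?case
    by auto
qed simp

section \<open>Ports, non-backtracking walks and the effect of girth\<close>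

locale port_graph =
  fixes G :: "('v, 'l) pgraph"
  assumes nbr_in: "v \<in> verts G \<Longrightarrow> i < deg G v \<Longrightarrow> nbr G v i \<in> verts G"
    and nbr_neq: "v \<in> verts G \<Longrightarrow> i < deg G v \<Longrightarrow> nbr G v i \<noteq> v"
    and nbr_inj: "v \<in> verts G \<Longrightarrow> inj_on (nbr G v) {..<deg G v}"
    and adj_back: "v \<in> verts G \<Longrightarrow> i < deg G v \<Longrightarrow> adj G (nbr G v i) v"
begin

lemma backport:
  assumes "v \<in> verts G" "i < deg G v"
  shows "backport G v i < deg G (nbr G v i)" "nbr G (nbr G v i) (backport G v i) = v"
proof -
  have "\<exists>j. j < deg G (nbr G v i) \<and> nbr G (nbr G v i) j = v"
    using adj_back[OF assms] by (auto simp: adj_def)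
  from someI_ex[OF this] show "backport G v i < deg G (nbr G v i)"
    "nbr G (nbr G v i) (backport G v i) = v"
    by (auto simp: backport_def)
qed

lemma backport_backport:
  assumes "v \<in> verts G" "i < deg G v"
  shows "backport G (nbr G v i) (backport G v i) = i"
proof -
  let ?u = "nbr G v i" and ?j = "backport G v i"
  have u: "?u \<in> verts G" by (rule nbr_in[OF assms])
  note j = backport[OF assms]
  have "backport G ?u ?j < deg G v" "nbr G v (backport G ?u ?j) = nbr G v i"
    using backport[OF u j(1)] j(2) by auto
  then show ?thesis
    using inj_onD[OF nbr_inj[OF assms(1)]] assms(2) by simp
qed

lemma evis_swap:
  assumes "v \<in> verts G" "i < deg G v"
  shows "evis k G (nbr G v i) (backport G v i) = evis k G v i"
  using backport[OF assms] backport_backport[OF assms] by (auto simp: evis_def)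

lemma vis_subset_verts:
  assumes "v \<in> verts G" shows "vis k G v ex \<subseteq> verts G"
  using assms
proof (induction k arbitrary: v ex)
  case (Suc k)
  show ?case
    unfolding vis_Suc using Suc.prems by (intro insert_subsetI UN_least Suc.IH nbr_in) simp_all
qed simp

lemma adj_sym: "x \<in> verts G \<Longrightarrow> adj G x y \<Longrightarrow> adj G y x"
  using adj_back by (auto simp: adj_def)

text \<open>A view never returns through the port by which it entered a node, so its exploration
  paths are of this kind.\<close>

definition nb_walk :: "'v list \<Rightarrow> bool" where
  "nb_walk p \<longleftrightarrow> set p \<subseteq> verts G \<and> (\<forall>k. Suc k < length p \<longrightarrow> adj G (p ! k) (p ! Suc k)) \<and>
     (\<forall>k. Suc (Suc k) < length p \<longrightarrow> p ! k \<noteq> p ! Suc (Suc k))"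

lemma nb_walk_Cons:
  assumes "nb_walk (y # z # r)" "x \<in> verts G" "adj G x y" "x \<noteq> z"
  shows "nb_walk (x # y # z # r)"
  using assms unfolding nb_walk_def by (auto simp: nth_Cons split: nat.split)

lemma nb_walk_rev:
  assumes "nb_walk p" shows "nb_walk (rev p)"
  unfolding nb_walk_def
proof (intro conjI allI impI)
  show "set (rev p) \<subseteq> verts G" using assms by (simp add: nb_walk_def)
next
  fix k assume k: "Suc k < length (rev p)"
  define l where "l = length p - Suc (Suc k)"
  have l: "length p - Suc k = Suc l" "Suc l < length p" using k by (auto simp: l_def)
  then have "adj G (p ! l) (p ! Suc l)" "p ! l \<in> verts G"
    using assms by (auto simp: nb_walk_def)
  then show "adj G (rev p ! k) (rev p ! Suc k)"
    using k l by (simp add: rev_nth l_def[symmetric] adj_sym)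
next
  fix k assume k: "Suc (Suc k) < length (rev p)"
  define l where "l = length p - Suc (Suc (Suc k))"
  have l: "length p - Suc k = Suc (Suc l)" "Suc (Suc l) < length p" using k by (auto simp: l_def)
  then have "p ! l \<noteq> p ! Suc (Suc l)"
    using assms by (auto simp: nb_walk_def)
  then show "rev p ! k \<noteq> rev p ! Suc (Suc k)"
    using k l by (simp add: rev_nth l_def[symmetric])
qed

text \<open>A shortest closed segment of a non-backtracking walk is a cycle.\<close>
lemma nb_walk_distinct:
  assumes p: "nb_walk p" and g: "girth_ge G m" and len: "length p \<le> m"
  shows "distinct p"
proof (rule ccontr)
  assume "\<not> distinct p"
  define Q where "Q d \<longleftrightarrow> 0 < d \<and> (\<exists>i. i + d < length p \<and> p ! i = p ! (i + d))" for d
  obtain i j where "i < j" "j < length p" "p ! i = p ! j"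
    using \<open>\<not> distinct p\<close> unfolding distinct_conv_nth by (metis linorder_neqE_nat)
  then have "Q (j - i)"
    by (auto simp: Q_def intro!: exI[of _ i])
  define d where "d = (LEAST d. Q d)"
  have "Q d" unfolding d_def by (rule LeastI) fact
  have least: "d \<le> e" if "Q e" for e unfolding d_def using that by (rule Least_le)
  obtain i where d: "0 < d" "i + d < length p" "p ! i = p ! (i + d)"
    using \<open>Q d\<close> by (auto simp: Q_def)
  define cs where "cs = take d (drop i p)"
  have cs: "length cs = d" "\<And>k. k < d \<Longrightarrow> cs ! k = p ! (i + k)"
    using d by (auto simp: cs_def)
  have vp: "set p \<subseteq> verts G" and adjp: "\<And>k. Suc k < length p \<Longrightarrow> adj G (p ! k) (p ! Suc k)"
    and nbp: "\<And>k. Suc (Suc k) < length p \<Longrightarrow> p ! k \<noteq> p ! Suc (Suc k)"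
    using p by (auto simp: nb_walk_def)
  have "d \<noteq> 1"
  proof
    assume "d = 1"
    then have "adj G (p ! i) (p ! i)" using adjp[of i] d by simp
    moreover have "p ! i \<in> verts G" using vp d by (simp add: subset_iff)
    ultimately show False using nbr_neq by (auto simp: adj_def)
  qed
  moreover have "d \<noteq> 2" using nbp[of i] d by (metis add_2_eq_Suc')
  ultimately have "3 \<le> d" using d(1) by linarith
  moreover have "distinct cs"
  proof (rule ccontr)
    assume "\<not> distinct cs"
    then obtain a b where "a < b" "b < d" "p ! (i + a) = p ! (i + b)"
      unfolding distinct_conv_nth using cs by (metis linorder_neqE_nat)
    then have "Q (b - a)"
      using d by (auto simp: Q_def intro!: exI[of _ "i + a"])
    then show False using least \<open>a < b\<close> \<open>b < d\<close> by fastforce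
  qed
  moreover have "set cs \<subseteq> verts G"
    using vp set_take_subset set_drop_subset unfolding cs_def by fast
  moreover have "adj G (cs ! k) (cs ! ((k + 1) mod d))" if "k < d" for k
  proof (cases "Suc k = d")
    case True
    then have "cs ! ((k + 1) mod d) = p ! Suc (i + k)"
      using cs(2)[of 0] d by (metis Suc_eq_plus1 add.right_neutral add_Suc_right mod_self)
    then show ?thesis
      using adjp[of "i + k"] cs(2)[OF that] d True by simp
  next
    case False
    then show ?thesis
      using adjp[of "i + k"] cs(2)[OF that] cs(2)[of "Suc k"] d that by simp
  qed
  ultimately have "is_cycle G cs"
    by (simp add: is_cycle_def cs(1))
  \<comment> \<open>Two equal entries of \<open>p\<close> are less than \<open>length p\<close>
    steps apart, so the cycle found is shorter than \<open>m\<close>.\<close>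
  then have "m \<le> d" using g cs(1) by (auto simp: girth_ge_def)
  then show False using d(2) len by simp
qed

text \<open>The walk grows at the front. The excluded port of \<open>v\<close> leads to the second
  node of the walk, so every child entered differs from that node and the walk never backtracks.
  Each level of the view adds at most one node, and \<open>hd (p @ [v])\<close> covers the case of
  empty \<open>p\<close>.\<close>

lemma nb_walk_to_vis:
  assumes "x \<in> vis k G v (Some i)" "v \<in> verts G" "i < deg G v" "nb_walk (v # nbr G v i # r)"
  shows "\<exists>p. length p \<le> k \<and> nb_walk (p @ v # nbr G v i # r) \<and> hd (p @ [v]) = x"
  using assms
proof (induction k arbitrary: v i r)
  case 0
  then show ?case by (intro exI[of _ "[]"]) simp
next
  case (Suc k)
  show ?case
  proof (cases "x = v")
    case True
    then show ?thesis using Suc.prems by (intro exI[of _ "[]"]) simp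
  next
    case False
    then obtain l where l: "l < deg G v" "l \<noteq> i"
        "x \<in> vis k G (nbr G v l) (Some (backport G v l))"
      using Suc.prems(1) by (auto simp: vis_Suc)
    let ?u = "nbr G v l"
    have u: "?u \<in> verts G" and bp: "backport G v l < deg G ?u" "nbr G ?u (backport G v l) = v"
      using nbr_in backport Suc.prems(2) l(1) by auto
    have "?u \<noteq> nbr G v i"
      using inj_onD[OF nbr_inj[OF Suc.prems(2)]] l(1,2) Suc.prems(3) by auto
    then have "nb_walk (?u # v # nbr G v i # r)"
      using nb_walk_Cons Suc.prems(2,4) u l(1) adj_back by blast
    then obtain p where "length p \<le> k" "nb_walk (p @ ?u # v # nbr G v i # r)" "hd (p @ [?u]) = x"
      using Suc.IH[OF l(3) u bp(1), of "nbr G v i # r"] bp(2) by auto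
    then show ?thesis
      by (intro exI[of _ "p @ [?u]"]) (auto simp: hd_append)
  qed
qed

text \<open>A node \<open>x\<close> on both sides would be both ends of a non-backtracking walk
  across the edge: at most \<open>a\<close> nodes, the two endpoints, at most \<open>b\<close>
  nodes. With \<open>a + b + 2 \<le> m\<close> such a walk repeats no node.\<close>

lemma vis_disjoint:
  assumes g: "girth_ge G m" and v: "v \<in> verts G" "i < deg G v" and ab: "a + b + 2 \<le> m"
  shows "vis a G v (Some i) \<inter> vis b G (nbr G v i) (Some (backport G v i)) = {}"
proof (rule ccontr)
  let ?u = "nbr G v i" and ?j = "backport G v i"
  assume "\<not> ?thesis"
  then obtain x where x: "x \<in> vis a G v (Some i)" "x \<in> vis b G ?u (Some ?j)" by blast
  have u: "?u \<in> verts G" using nbr_in v by blast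
  note bp = backport[OF v]
  have "nb_walk [?u, v]"
    using u v adj_back by (auto simp: nb_walk_def)
  then obtain p where p: "length p \<le> b" "nb_walk (p @ [?u, v])" "hd (p @ [?u]) = x"
    using nb_walk_to_vis[OF x(2) u bp(1), of "[]"] bp(2) by auto
  have "nb_walk (v # ?u # rev p)"
    using nb_walk_rev[OF p(2)] by simp
  then obtain q where q: "length q \<le> a" "nb_walk (q @ v # ?u # rev p)" "hd (q @ [v]) = x"
    using nb_walk_to_vis[OF x(1) v] by auto
  have "distinct ((q @ [v]) @ (?u # rev p))"
    using nb_walk_distinct[OF q(2) g] p(1) q(1) ab by simp
  moreover have "x \<in> set (q @ [v])" "x \<in> set (p @ [?u])"
    using hd_in_set[of "q @ [v]"] hd_in_set[of "p @ [?u]"] p(3) q(3) by (metis snoc_eq_iff_butlast)+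
  ultimately show False by auto
qed

text \<open>When the edge behind port \<open>i\<close> is cut, the branch behind port
  \<open>l\<close> belongs to the side of \<open>v\<close> at depth \<open>Suc k\<close>; this gives
  \<open>(k + 1) + k + 2\<close> as the bound.\<close>

lemma vis_children_disjoint:
  assumes g: "girth_ge G m" and v: "v \<in> verts G" "i < deg G v" "l < deg G v" "i \<noteq> l"
    and k: "2 * k + 3 \<le> m"
  shows "vis k G (nbr G v i) (Some (backport G v i)) \<inter>
    vis k G (nbr G v l) (Some (backport G v l)) = {}"
proof -
  have "vis k G (nbr G v l) (Some (backport G v l)) \<subseteq> vis (Suc k) G v (Some i)"
    using v by (auto simp: vis_Suc)
  then show ?thesis
    using vis_disjoint[OF g v(1,2), of "Suc k" k] k by auto
qed

lemma distinct_labels_pview: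
  assumes g: "girth_ge G m" and "v \<in> verts G" "2 * k + 1 \<le> m"
  shows "distinct (labels (pview k G (\<lambda>x. x) v ex))"
  using assms(2,3)
proof (induction k arbitrary: v ex)
  case (Suc k)
  define f where "f i = (if ex = Some i then []
    else labels (pview k G (\<lambda>x. x) (nbr G v i) (Some (backport G v i))))" for i
  have sub: "set (f i) \<subseteq> vis k G (nbr G v i) (Some (backport G v i))" for i
    by (simp add: f_def set_labels vis_def)
  have "labels (pview (Suc k) G (\<lambda>x. x) v ex) = v # concat (map f [0..<deg G v])"
    by (auto simp: f_def intro!: arg_cong[of _ _ concat])
  moreover have "v \<notin> set (f i)" if "i < deg G v" for i
    using vis_disjoint[OF g Suc.prems(1) that, of 0 k] sub[of i] Suc.prems(2) by auto
  moreover have "distinct (f i)" if "i < deg G v" for i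
    using Suc.IH nbr_in[OF Suc.prems(1) that] Suc.prems(2) by (simp add: f_def)
  moreover have "set (f i) \<inter> set (f l) = {}" if "i < deg G v" "l < deg G v" "i \<noteq> l" for i l
    using Int_mono[OF sub[of i] sub[of l]] vis_children_disjoint[OF g Suc.prems(1) that, of k]
      Suc.prems(2) by auto
  ultimately show ?case
    using distinct_concat_map_upt[of "deg G v" f] by auto
qed simp

lemma distinct_labels_epview:
  assumes g: "girth_ge G m" and "v \<in> verts G" "i < deg G v" "2 * k + 2 \<le> m"
  shows "distinct (labels (epview k G (\<lambda>x. x) v i))"
  using distinct_labels_pview[OF g] nbr_in vis_disjoint[OF g assms(2,3), of k k] assms(2-4)
  by (simp add: epview_def set_labels vis_def mult_2)

text \<open>The tightest use of girth: both sides of the edge are explored to depth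
  \<open>Suc k\<close>, which takes \<open>2 * (k + 1) + 2\<close> nodes. As these sides are
  disjoint, the balls share only what one of them sees across the edge, to depth
  \<open>k\<close>.\<close>

lemma vis_inter_nbr:
  assumes g: "girth_ge G (2 * k + 4)" and v: "v \<in> verts G" "i < deg G v"
  shows "vis (Suc k) G v None \<inter> vis (Suc k) G (nbr G v i) None = evis k G v i"
proof -
  let ?u = "nbr G v i" and ?j = "backport G v i"
  have split: "vis (Suc k) G x None =
      vis (Suc k) G x (Some l) \<union> vis k G (nbr G x l) (Some (backport G x l))"
    if "l < deg G x" for x l
    using that by (auto simp: vis_Suc)
  have "vis (Suc k) G v (Some i) \<inter> vis (Suc k) G ?u (Some ?j) = {}"
    using vis_disjoint[OF g v, of "Suc k" "Suc k"] by simp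
  then show ?thesis
    using split[OF v(2)] split[OF backport(1)[OF v]] backport(2)[OF v] backport_backport[OF v]
      vis_le_Suc[of k G v "Some i"] vis_le_Suc[of k G ?u "Some ?j"]
    unfolding evis_def by auto
qed

text \<open>Provides the sets and the core for \<open>same_order_star_amalgam\<close>: each edge
  neighbourhood exceeds the ball only by nodes in the branch behind its own port.\<close>

lemma evis_inter:
  assumes g: "girth_ge G (2 * k + 4)" and v: "v \<in> verts G" "i < deg G v" "l < deg G v" "i \<noteq> l"
  shows "evis k G v i \<inter> evis k G v l = vis k G v None"
  using vis_children_disjoint[OF g v, of k] vis_subset_evis[of k G v i] vis_subset_evis[of k G v l]
    vis_exclude[of k G v "Some i"] vis_exclude[of k G v "Some l"] unfolding evis_def by auto

lemma distinct_labels_ids: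
  assumes "inj_on idf (verts G)" "distinct (labels V)" "set1_view V \<subseteq> verts G"
  shows "distinct (labels (map_view idf id V))"
  using assms by (metis distinct_map inj_on_subset labels_map_view set_labels)

end

lemma epview_eq_swap:
  assumes "port_graph G" "port_graph G'" and v: "v \<in> verts G" "i < deg G v"
    and v': "v' \<in> verts G'" "i < deg G' v'"
    and eq: "epview k G a v i = epview k G' a' v' i"
  shows "epview k G a (nbr G v i) (backport G v i) =
    epview k G' a' (nbr G' v' i) (backport G' v' i)"
  using port_graph.backport[OF assms(1) v] port_graph.backport[OF assms(2) v']
    port_graph.backport_backport[OF assms(1) v] port_graph.backport_backport[OF assms(2) v'] eq
  by (auto simp: epview_def)

lemma order_equiv_swap:
  assumes G: "port_graph G" "port_graph G'" and v: "v \<in> verts G" "i < deg G v"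
    and v': "v' \<in> verts G'" "i < deg G' v'"
    and eq: "order_equiv (epview k G a v i) (epview k G' a' v' i)"
  shows "order_equiv (epview k G a (nbr G v i) (backport G v i))
    (epview k G' a' (nbr G' v' i) (backport G' v' i))"
proof -
  obtain s where s: "strict_mono_on (a ` evis k G v i) s"
      and "epview k G' a' v' i = epview k G (s \<circ> a) v i"
    using eq by (auto simp: order_equiv_def epview_map set1_epview)
  then have "epview k G' a' (nbr G' v' i) (backport G' v' i) =
      map_view s id (epview k G a (nbr G v i) (backport G v i))"
    using epview_eq_swap[OF G v v', of k "s \<circ> a" a'] by (simp add: epview_map)
  then show ?thesis
    using s by (auto simp: order_equiv_def set1_epview port_graph.evis_swap[OF G(1) v])
qed

section \<open>Derived problems\<close>

lemma pair_mset_eq_iff: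
  "{#a, b#} = {#c, d#} \<longleftrightarrow> a = c \<and> b = d \<or> a = d \<and> b = c"
  by (auto simp: add_eq_conv_ex)

lemma edgec_half_iff:
  "{#Y, Z#} \<in> edgec (half P) D \<longleftrightarrow> Y \<subseteq> outs P D \<and> Z \<subseteq> outs P D \<and> allcomp P D Y Z"
  by (auto simp: half_def pair_mset_eq_iff allcomp_def) (metis add_mset_commute)

lemma edgec_one_from_iff:
  "{#Y, Z#} \<in> edgec (one_from Q) D \<longleftrightarrow> Y \<subseteq> outs Q D \<and> Z \<subseteq> outs Q D \<and>
     (\<exists>y\<in>Y. \<exists>z\<in>Z. {#y, z#} \<in> edgec Q D)"
  by (auto simp: one_from_def pair_mset_eq_iff) (metis add_mset_commute)

lemma edgec_half'_subset: "edgec (half' P) D \<subseteq> edgec (half P) D"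
  by (auto simp: half_def half'_def)

lemma outs_half' [simp]: "outs (half' P) D = Pow (outs P D)"
  and outs_half [simp]: "outs (half P) D = Pow (outs P D)"
  and nodec_half' [simp]: "nodec (half' P) D = nodec (half P) D"
  by (auto simp: half_def half'_def)

lemma allnode_half' [simp]: "allnode (half' P) D M = allnode (half P) D M"
  by (simp add: allnode_def)

lemma outs_one [simp]: "outs (one P) D = Pow (Pow (outs P D))"
  and outs_one' [simp]: "outs (one' P) D = Pow (Pow (outs P D))"
  by (simp_all add: one_def one'_def one_from_def)

lemma nodec_one_iff:
  "M \<in> nodec (one P) D \<longleftrightarrow>
     size M \<le> D \<and> set_mset M \<subseteq> Pow (Pow (outs P D)) \<and> allnode (half P) D M"
  by (simp add: one_def one_from_def)

lemma nodec_one'_iff: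
  "M \<in> nodec (one' P) D \<longleftrightarrow> M \<in> nodec (one P) D \<and>
     (\<forall>Y\<in>#M. \<forall>Y'. Y \<subset> Y' \<and> Y' \<subseteq> Pow (outs P D) \<longrightarrow>
        \<not> allnode (half P) D (add_mset Y' (M - {#Y#})))"
  by (simp add: one'_def one_def one_from_def)

lemma edgec_one_iff:
  "{#Y, Z#} \<in> edgec (one P) D \<longleftrightarrow> Y \<subseteq> Pow (outs P D) \<and> Z \<subseteq> Pow (outs P D) \<and>
     (\<exists>y\<in>Y. \<exists>z\<in>Z. {#y, z#} \<in> edgec (half P) D)"
  by (simp add: one_def edgec_one_from_iff)

lemma edgec_one'_iff:
  "{#Y, Z#} \<in> edgec (one' P) D \<longleftrightarrow> Y \<subseteq> Pow (outs P D) \<and> Z \<subseteq> Pow (outs P D) \<and>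
     (\<exists>y\<in>Y. \<exists>z\<in>Z. {#y, z#} \<in> edgec (half' P) D)"
  by (simp add: one'_def edgec_one_from_iff)

section \<open>The derived problem and its simplified version\<close>

lemma solves_one_of_one':
  assumes "solves_with_ids (one' P) D A k C S"
  shows "solves_with_ids (one P) D A k C S"
proof -
  have "{#Y, Z#} \<in> edgec (one P) D" if "{#Y, Z#} \<in> edgec (one' P) D" for Y Z
    using that edgec_half'_subset[of P D] by (auto simp: edgec_one_iff edgec_one'_iff)
  then show ?thesis
    using assms by (auto simp: solves_with_ids_def solves_on_def Let_def nodec_one'_iff)
qed

text \<open>Among the enlargements of \<open>Ys\<close> that keep (Q), one of largest total
  cardinality is maximal in every entry. Lists instead of multisets keep each set at its
  port.\<close>

lemma maximal_completion:
  assumes fin: "finite (outs Q D)" and Ys: "set Ys \<subseteq> Pow (outs Q D)" "allnode Q D (mset Ys)"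
  shows "\<exists>Zs. list_all2 (\<subseteq>) Ys Zs \<and> set Zs \<subseteq> Pow (outs Q D) \<and> allnode Q D (mset Zs) \<and>
    (\<forall>Y\<in>#mset Zs. \<forall>Y'. Y \<subset> Y' \<and> Y' \<subseteq> outs Q D \<longrightarrow>
        \<not> allnode Q D (add_mset Y' (mset Zs - {#Y#})))"
proof -
  define ok where "ok Zs \<longleftrightarrow> list_all2 (\<subseteq>) Ys Zs \<and> set Zs \<subseteq> Pow (outs Q D) \<and> allnode Q D (mset Zs)"
    for Zs
  define wt where "wt Zs = sum_list (map card Zs)" for Zs :: "'a set list"
  have "ok Ys" using Ys by (simp add: ok_def list_all2_refl)
  moreover have "wt Zs < Suc (length Ys * card (outs Q D))" if "ok Zs" for Zs
  proof -
    have "wt Zs \<le> length Zs * card (outs Q D)"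
      using that fin unfolding wt_def ok_def
      by (intro order_trans[OF sum_list_mono[of Zs card "\<lambda>_. card (outs Q D)"]])
        (auto simp: card_mono sum_list_triv subset_iff)
    then show ?thesis using that by (auto simp: ok_def dest: list_all2_lengthD)
  qed
  ultimately obtain Zs where Zs: "ok Zs" and max: "\<And>Xs. ok Xs \<Longrightarrow> wt Xs \<le> wt Zs"
    using ex_has_greatest_nat[of ok Ys wt "Suc (length Ys * card (outs Q D))"] by auto
  have "\<not> allnode Q D (add_mset Y' (mset Zs - {#Y#}))"
    if Y: "Y \<in># mset Zs" "Y \<subset> Y'" "Y' \<subseteq> outs Q D" for Y Y'
  proof
    assume a: "allnode Q D (add_mset Y' (mset Zs - {#Y#}))"
    obtain l where l: "l < length Zs" "Zs ! l = Y"
      using Y(1) by (auto simp: in_set_conv_nth)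
    let ?Xs = "Zs[l := Y']"
    have len: "length Ys = length Zs" using Zs by (auto simp: ok_def dest: list_all2_lengthD)
    have "Ys ! m \<subseteq> ?Xs ! m" if "m < length Ys" for m
      using Zs that l Y(2) len list_all2_nthD[of "(\<subseteq>)" Ys Zs m]
      by (cases "m = l") (auto simp: ok_def)
    then have "list_all2 (\<subseteq>) Ys ?Xs"
      by (simp add: list_all2_conv_all_nth len)
    moreover have "set ?Xs \<subseteq> Pow (outs Q D)"
      using Zs Y(3) set_update_subset_insert[of Zs l Y'] by (auto simp: ok_def)
    moreover have "allnode Q D (mset ?Xs)"
      using a l by (simp add: mset_update)
    ultimately have "wt ?Xs \<le> wt Zs" using max by (simp add: ok_def)
    moreover have "wt ?Xs = wt Zs + card Y' - card Y"
      using l by (simp add: wt_def map_update sum_list_update)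
    moreover have "card Y < card Y'"
      using Y fin by (meson finite_subset psubset_card_mono)
    ultimately show False by linarith
  qed
  then show ?thesis
    using Zs unfolding ok_def by (intro exI[of _ Zs]) blast
qed

lemma nodec_half_mono:
  assumes "add_mset y N \<in> nodec (half P) D" "y \<subseteq> y'" "y' \<subseteq> outs P D"
  shows "add_mset y' N \<in> nodec (half P) D"
proof -
  obtain K where K: "K \<in> nodec P D" "rel_mset (\<lambda>Y y. y \<in> Y) (add_mset y N) K"
    using assms(1) by (auto simp: half_def)
  obtain K' c where "K = add_mset c K'" "c \<in> y" "rel_mset (\<lambda>Y y. y \<in> Y) N K'"
    using msed_rel_invL[OF K(2)] by blast
  then have "rel_mset (\<lambda>Y y. y \<in> Y) (add_mset y' N) K"
    using assms(2) rel_mset_Plus[of "\<lambda>Y y. y \<in> Y" y' c N K'] by auto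
  then show ?thesis
    using assms K(1) by (auto simp: half_def)
qed

text \<open>The node constraint of \<open>half P\<close> asks only for some elements of the sets, so
  it survives enlarging a set. Adding a superset of a member to \<open>Y\<close> thus preserves (Q),
  and by maximality it was there already.\<close>

lemma maximal_upward_closed:
  assumes M: "allnode (half P) D M" "Y \<in># M" "Y \<subseteq> Pow (outs P D)"
    and max: "\<And>Y'. Y \<subset> Y' \<Longrightarrow> Y' \<subseteq> Pow (outs P D) \<Longrightarrow>
        \<not> allnode (half P) D (add_mset Y' (M - {#Y#}))"
    and y: "y \<in> Y" "y \<subseteq> y'" "y' \<subseteq> outs P D"
  shows "y' \<in> Y"
proof (rule ccontr)
  assume "y' \<notin> Y"
  have MY: "add_mset Y (M - {#Y#}) = M" using M(2) by simp
  have "N \<in> nodec (half P) D"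
    if N: "rel_mset (\<lambda>Y y. y \<in> Y) (add_mset (insert y' Y) (M - {#Y#})) N" for N
  proof -
    obtain N' c where c: "N = add_mset c N'" "c \<in> insert y' Y"
        and r: "rel_mset (\<lambda>Y y. y \<in> Y) (M - {#Y#}) N'"
      using msed_rel_invL[OF N] by blast
    have "add_mset x N' \<in> nodec (half P) D" if "x \<in> Y" for x
      using rel_mset_Plus[of "\<lambda>Y y. y \<in> Y" Y x, OF that r] M(1) unfolding MY allnode_def by blast
    then show ?thesis
      using c y nodec_half_mono[of y N' P D y'] by auto
  qed
  then have "allnode (half P) D (add_mset (insert y' Y) (M - {#Y#}))"
    by (simp add: allnode_def)
  moreover have "Y \<subset> insert y' Y" "insert y' Y \<subseteq> Pow (outs P D)"
    using \<open>y' \<notin> Y\<close> M(3) y(3) by auto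
  ultimately show False using max by blast
qed

lemma maximal_superset:
  assumes "finite U" "y \<subseteq> U" "Q y"
  obtains m where "y \<subseteq> m" "m \<subseteq> U" "Q m" "\<forall>x. m \<subset> x \<and> x \<subseteq> U \<longrightarrow> \<not> Q x"
proof -
  let ?X = "{x. x \<subseteq> U \<and> Q x}"
  have "finite ?X" using assms(1) by simp
  moreover have "y \<in> ?X" using assms by simp
  ultimately obtain m where m: "m \<in> ?X" "y \<subseteq> m" and max: "\<forall>b\<in>?X. m \<subseteq> b \<longrightarrow> m = b"
    by (rule finite_has_maximal2[THEN bexE]) simp
  show thesis
    by (rule that[of m]) (use m max in auto)
qed

text \<open>Enlarging \<open>y\<close> first and \<open>z\<close> second suffices: a larger second
  set admits fewer first sets, so \<open>y'\<close> stays maximal.\<close>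

lemma maximal_edge:
  assumes fin: "finite (outs P D)" and yz: "{#y, z#} \<in> edgec (half P) D"
  obtains y' z' where "y \<subseteq> y'" "z \<subseteq> z'" "y' \<subseteq> outs P D" "z' \<subseteq> outs P D"
    "{#y', z'#} \<in> edgec (half' P) D"
proof -
  have yz': "y \<subseteq> outs P D" "z \<subseteq> outs P D" "allcomp P D y z"
    using yz by (auto simp: edgec_half_iff)
  obtain y' where y': "y \<subseteq> y'" "y' \<subseteq> outs P D" "allcomp P D y' z"
      and ymax: "\<forall>x. y' \<subset> x \<and> x \<subseteq> outs P D \<longrightarrow> \<not> allcomp P D x z"
    by (rule maximal_superset[of "outs P D" y "\<lambda>x. allcomp P D x z"]) (use fin yz' in auto)
  obtain z' where z': "z \<subseteq> z'" "z' \<subseteq> outs P D" "allcomp P D y' z'"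
      and zmax: "\<forall>x. z' \<subset> x \<and> x \<subseteq> outs P D \<longrightarrow> \<not> allcomp P D y' x"
    by (rule maximal_superset[of "outs P D" z "\<lambda>x. allcomp P D y' x"]) (use fin yz' y' in auto)
  have "allcomp P D x z" if "allcomp P D x z'" for x
    using that z'(1) by (auto simp: allcomp_def)
  then have "\<forall>x. y' \<subset> x \<and> x \<subseteq> outs P D \<longrightarrow> \<not> allcomp P D x z'"
    using ymax by metis
  then have "{#y', z'#} \<in> edgec (half' P) D"
    using y' z' zmax unfolding half'_def lcl_problem.select_convs mem_Collect_eq
    by (intro exI[of _ y'] exI[of _ z'] conjI refl)
  then show thesis using that y' z' by blast
qed

text \<open>Read off the input labels, since a view of radius 0 has an empty child list at any
  degree.\<close>

fun view_deg :: "('a, 'l) view \<Rightarrow> nat" where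
  "view_deg (View a ls cs) = length ls"

lemma view_deg_pview [simp]: "view_deg (pview k G a v ex) = deg G v"
  by (cases k) auto

lemma view_deg_map [simp]: "view_deg (map_view f g V) = view_deg V"
  by (cases V) auto

text \<open>No communication is needed: each node enlarges its own outputs to a maximal choice.  Such a
  choice is closed under supersets, so it contains the maximal pairs required on the edges.\<close>
lemma one'_of_one:
  fixes P :: "'o lcl_problem" and A :: "(nat, 'l) view \<Rightarrow> nat \<Rightarrow> 'o set set"
  assumes fin: "finite (outs P D)" and graphs: "\<And>G. G \<in> C \<Longrightarrow> port_graph G"
    and inv: "order_invariant A" and sol: "solves_with_ids (one P) D A k C S"
  shows "\<exists>B :: (nat, 'l) view \<Rightarrow> nat \<Rightarrow> 'o set set.
    order_invariant B \<and> solves_with_ids (one' P) D B k C S"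
proof -
  define ok where "ok Ys Zs \<longleftrightarrow> list_all2 (\<subseteq>) Ys Zs \<and> set Zs \<subseteq> Pow (Pow (outs P D)) \<and>
    allnode (half P) D (mset Zs) \<and>
    (\<forall>Y\<in>#mset Zs. \<forall>Y'. Y \<subset> Y' \<and> Y' \<subseteq> Pow (outs P D) \<longrightarrow>
        \<not> allnode (half P) D (add_mset Y' (mset Zs - {#Y#})))" for Ys Zs
  define compl where "compl Ys = (SOME Zs. ok Ys Zs)" for Ys
  have compl: "ok Ys (compl Ys)" if "mset Ys \<in> nodec (one P) D" for Ys
    unfolding compl_def ok_def
    by (rule someI_ex) (use maximal_completion[of "half P" D Ys] that fin in \<open>auto simp: nodec_one_iff\<close>)
  \<comment> \<open>The completion is one fixed function of the node's own list of outputs, so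
    \<open>B\<close> depends on the view only through \<open>A\<close> and the degree, and inherits
    order-invariance.\<close>
  define B where "B V i = compl (map (A V) [0..<view_deg V]) ! i" for V i
  have "order_invariant B"
    using inv unfolding order_invariant_def B_def fun_eq_iff[of "B _"] by auto
  moreover have "solves_on (one' P) D B k G idf"
    if G: "G \<in> C" "inj_on idf (verts G)" "idf ` verts G \<subseteq> S" for G idf
  proof -
    interpret port_graph G using graphs G by blast
    define oA where "oA v = A (pview k G idf v None)" for v
    define oB where "oB v = B (pview k G idf v None)" for v
    have "solves_on (one P) D A k G idf"
      using sol G by (auto simp: solves_with_ids_def)
    then have edgeA: "\<And>v i. v \<in> verts G \<Longrightarrow> i < deg G v \<Longrightarrow>
          {#oA v i, oA (nbr G v i) (backport G v i)#} \<in> edgec (one P) D"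
      and nodeA: "\<And>v. v \<in> verts G \<Longrightarrow> mset (map (oA v) [0..<deg G v]) \<in> nodec (one P) D"
      by (auto simp: solves_on_def Let_def oA_def)
    have oB: "oB v i = compl (map (oA v) [0..<deg G v]) ! i" for v i
      by (simp add: oB_def B_def oA_def)
    have ok: "ok (map (oA v) [0..<deg G v]) (map (oB v) [0..<deg G v])" if "v \<in> verts G" for v
    proof -
      have o: "ok (map (oA v) [0..<deg G v]) (compl (map (oA v) [0..<deg G v]))"
        using compl nodeA that by blast
      then have "length (compl (map (oA v) [0..<deg G v])) = deg G v"
        by (auto simp: ok_def dest: list_all2_lengthD)
      then have "compl (map (oA v) [0..<deg G v]) = map (oB v) [0..<deg G v]"
        by (intro nth_equalityI) (auto simp: oB)
      then show ?thesis using o by simp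
    qed
    have sub: "oA v i \<subseteq> oB v i" "oB v i \<subseteq> Pow (outs P D)" if "v \<in> verts G" "i < deg G v" for v i
      using ok[OF that(1)] that(2) by (fastforce simp: ok_def list_all2_conv_all_nth)+
    have up: "y' \<in> oB v i"
      if v: "v \<in> verts G" "i < deg G v" and y: "y \<in> oB v i" "y \<subseteq> y'" "y' \<subseteq> outs P D" for v i y y'
      using maximal_upward_closed[OF _ _ _ _ y, of "mset (map (oB v) [0..<deg G v])"]
        ok[OF v(1)] sub[OF v] v(2) unfolding ok_def by auto
    have node: "mset (map (oB v) [0..<deg G v]) \<in> nodec (one' P) D" if "v \<in> verts G" for v
      using ok[OF that] nodeA[OF that] unfolding nodec_one'_iff nodec_one_iff ok_def by auto
    have edge: "{#oB v i, oB (nbr G v i) (backport G v i)#} \<in> edgec (one' P) D"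
      if v: "v \<in> verts G" "i < deg G v" for v i
    proof -
      let ?u = "nbr G v i" and ?j = "backport G v i"
      have u: "?u \<in> verts G" "?j < deg G ?u"
        using nbr_in backport(1) v by auto
      obtain y z where yz: "y \<in> oA v i" "z \<in> oA ?u ?j" "{#y, z#} \<in> edgec (half P) D"
        using edgeA[OF v] by (auto simp: edgec_one_iff)
      obtain y' z' where y'z': "y \<subseteq> y'" "z \<subseteq> z'" "y' \<subseteq> outs P D" "z' \<subseteq> outs P D"
          "{#y', z'#} \<in> edgec (half' P) D"
        using maximal_edge[OF fin yz(3)] by blast
      have "y' \<in> oB v i" "z' \<in> oB ?u ?j"
        using up[OF v, of y y'] up[OF u, of z z'] sub(1)[OF v] sub(1)[OF u] yz y'z' by auto
      then show ?thesis
        using y'z'(5) sub(2)[OF v] sub(2)[OF u] unfolding edgec_one'_iff by blast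
    qed
    show ?thesis
      using node edge sub(2) by (auto simp: solves_on_def Let_def oB_def)
  qed
  ultimately show ?thesis
    by (auto simp: solves_with_ids_def)
qed

section \<open>Speeding up and slowing down by one round\<close>

lemma order_invariantD: "order_invariant A \<Longrightarrow> order_equiv V W \<Longrightarrow> A V = A W"
  by (auto simp: order_invariant_def order_equiv_def)

text \<open>All situations in which a correctness condition evaluates an algorithm; they serve as
  the index set in \<open>order_invariant_extension\<close>.\<close>

definition realizations ::
    "('v, 'l) pgraph set \<Rightarrow> nat set \<Rightarrow> (('v, 'l) pgraph \<times> ('v \<Rightarrow> nat) \<times> 'v) set" where
  "realizations C S = {(G, a, v). G \<in> C \<and> v \<in> verts G \<and> inj_on a (verts G) \<and> a ` verts G \<subseteq> S}"

text \<open>Makes the tie-break legitimate: which endpoint has the smaller identifier is part of the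
  order type of the edge neighbourhood.\<close>

lemma order_equiv_epview_less:
  assumes "order_equiv (epview k G a v i) (epview k G' a' v' i)"
  shows "a v < a (nbr G v i) \<longleftrightarrow> a' v' < a' (nbr G' v' i)"
proof -
  obtain s where s: "strict_mono_on (a ` evis k G v i) s"
      and "epview k G' a' v' i = epview k G (s \<circ> a) v i"
    using assms by (auto simp: order_equiv_def epview_map set1_epview)
  then have 1: "pview k G' a' v' (Some i) = pview k G (s \<circ> a) v (Some i)"
    and 2: "pview k G' a' (nbr G' v' i) (Some (backport G v i)) =
      pview k G (s \<circ> a) (nbr G v i) (Some (backport G v i))"
    by (auto simp: epview_def)
  have "a' v' = s (a v)" "a' (nbr G' v' i) = s (a (nbr G v i))"
    using pview_eq_root[OF 1] pview_eq_root[OF 2] by auto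
  then show ?thesis
    using strict_mono_on_less[OF s] by (auto simp: evis_def root_in_vis)
qed

text \<open>Multisets forget which witness belongs to which port; reordering the witnesses restores
  the indexing by ports.\<close>

lemma rel_mset_mapE:
  assumes "rel_mset R (mset (map f [0..<d])) N"
  obtains g where "N = mset (map g [0..<d])" "\<And>i. i < d \<Longrightarrow> R (f i) (g i)"
proof -
  obtain xs ys where xy: "mset xs = mset (map f [0..<d])" "mset ys = N" "list_all2 R xs ys"
    using assms by (auto simp: rel_mset_def)
  obtain zs where zs: "list_all2 R (map f [0..<d]) zs" "mset zs = mset ys"
    using list_all2_reorder_left_invariance[OF xy(3), of "map f [0..<d]"] xy(1) by auto
  then have "length zs = d"
    by (auto dest: list_all2_lengthD)
  then have "zs = map (nth zs) [0..<d]"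
    by (metis map_nth)
  moreover have "R (f i) (zs ! i)" if "i < d" for i
    using list_all2_nthD[OF zs(1), of i] that by simp
  ultimately show thesis
    using that[of "nth zs"] zs(2) xy(2) by simp
qed

lemma rel_mset_mapI:
  assumes "\<And>i. i < d \<Longrightarrow> R (f i) (g i)"
  shows "rel_mset R (mset (map f [0..<d])) (mset (map g [0..<d]))"
  unfolding rel_mset_def using assms
  by (intro exI[of _ "map f [0..<d]"] exI[of _ "map g [0..<d]"]) (simp add: list_all2_conv_all_nth)

text \<open>One more round shows a node the outputs of \<open>B\<close> at both ends of its edges.
  The ends of an edge settle on one compatible pair of sets; by (Q) the sets settled on at a node
  contain elements meeting its node constraint, and by (P) any two elements across the pair are
  compatible, so the nodes can choose independently.\<close>

lemma slowdown:
  fixes P :: "'o lcl_problem" and B :: "(nat, 'l) view \<Rightarrow> nat \<Rightarrow> 'o set set"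
    and C :: "('v, 'l) pgraph set"
  assumes graphs: "\<And>G. G \<in> C \<Longrightarrow> port_graph G"
    and inv: "order_invariant B" and sol: "solves_with_ids (one P) D B k C S"
  shows "\<exists>A :: (nat, 'l) view \<Rightarrow> nat \<Rightarrow> 'o.
    order_invariant A \<and> solves_with_ids P D A (Suc k) C S"
proof -
  \<comment> \<open>The pair chosen for \<open>(Y, Z)\<close> need not be the swap of the one for
    \<open>(Z, Y)\<close>, and for \<open>Y = Z\<close> it may be asymmetric. Putting the endpoint
    with the smaller identifier first makes both ends evaluate the same \<open>sel\<close>.\<close>
  define sel where "sel Y Z = (SOME yz. fst yz \<in> Y \<and> snd yz \<in> Z \<and>
    {#fst yz, snd yz#} \<in> edgec (half P) D)" for Y Z
  define pick where "pick d f = (SOME x. (\<forall>i<d. x i \<in> f i) \<and> mset (map x [0..<d]) \<in> nodec P D)"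
    for d and f :: "nat \<Rightarrow> 'o set"
  define oB where "oB G a v = B (pview k G a v None)" for G :: "('v, 'l) pgraph" and a v
  \<comment> \<open>The value \<open>{}\<close> beyond the ports makes \<open>c\<close> agree as a
    whole function on order-equivalent views, so \<open>pick\<close> receives identical
    arguments.\<close>
  define c where "c G a v i = (if i < deg G v then
      let u = nbr G v i; Y = oB G a v i; Z = oB G a u (backport G v i)
      in if a v < a u then fst (sel Y Z) else snd (sel Z Y) else {})" for G a v i
  define F where "F = (\<lambda>(G, a, v). pick (deg G v) (c G a v))"
  have "F r = F s" if rs: "r \<in> realizations C S" "s \<in> realizations C S"
      and eq: "order_equiv ((\<lambda>(G, a, v). pview (Suc k) G a v None) r)
        ((\<lambda>(G, a, v). pview (Suc k) G a v None) s)" for r s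
  proof -
    obtain G a v where r: "r = (G, a, v)" by (cases r)
    obtain G' a' v' where s: "s = (G', a', v')" by (cases s)
    have eq: "order_equiv (pview (Suc k) G a v None) (pview (Suc k) G' a' v' None)"
      using eq by (simp only: r s split_conv)
    have G: "port_graph G" "port_graph G'" and v: "v \<in> verts G" "v' \<in> verts G'"
      using rs graphs by (auto simp: realizations_def r s)
    have d: "deg G v = deg G' v'" using eq by (rule order_equiv_deg)
    have "c G a v i = c G' a' v' i" for i
    proof (cases "i < deg G v")
      case True
      then have i: "i < deg G v" "i < deg G' v'" using d by auto
      have e: "order_equiv (epview k G a v i) (epview k G' a' v' i)"
        using eq True by (rule order_equiv_epview)
      have "oB G a v = oB G' a' v'"
        unfolding oB_def by (rule order_invariantD[OF inv order_equiv_pview[OF e]])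
      moreover have bp: "backport G v i = backport G' v' i"
        using e by (rule order_equiv_backport)
      moreover have "oB G a (nbr G v i) = oB G' a' (nbr G' v' i)"
        using order_equiv_swap[OF G v(1) i(1) v(2) i(2) e] unfolding oB_def bp
        by (intro order_invariantD[OF inv order_equiv_pview])
      ultimately show ?thesis
        using order_equiv_epview_less[OF e] i by (simp add: c_def Let_def)
    qed (simp add: c_def d)
    then have "c G a v = c G' a' v'" by blast
    then show ?thesis by (simp add: F_def r s d)
  qed
  then obtain A where A: "order_invariant A"
      and AF: "\<And>r. r \<in> realizations C S \<Longrightarrow> A ((\<lambda>(G, a, v). pview (Suc k) G a v None) r) = F r"
    by (rule order_invariant_extension[where R = "realizations C S" and F = F
          and vw = "\<lambda>(G, a, v). pview (Suc k) G a v None"]) blast+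
  have "solves_on P D A (Suc k) G a"
    if G: "G \<in> C" "inj_on a (verts G)" "a ` verts G \<subseteq> S" for G a
  proof -
    interpret port_graph G using graphs G by blast
    define x where "x v = pick (deg G v) (c G a v)" for v
    have AX: "A (pview (Suc k) G a v None) = x v" if "v \<in> verts G" for v
      using AF[of "(G, a, v)"] G that
      by (simp add: realizations_def F_def x_def del: pview.simps)
    have "solves_on (one P) D B k G a"
      using sol G by (auto simp: solves_with_ids_def)
    then have edgeB: "\<And>v i. v \<in> verts G \<Longrightarrow> i < deg G v \<Longrightarrow>
          {#oB G a v i, oB G a (nbr G v i) (backport G v i)#} \<in> edgec (one P) D"
      and nodeB: "\<And>v. v \<in> verts G \<Longrightarrow> mset (map (oB G a v) [0..<deg G v]) \<in> nodec (one P) D"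
      by (auto simp: solves_on_def Let_def oB_def)
    have c: "c G a v i \<in> oB G a v i \<and>
        {#c G a v i, c G a (nbr G v i) (backport G v i)#} \<in> edgec (half P) D"
      if v: "v \<in> verts G" "i < deg G v" for v i
    proof -
      let ?u = "nbr G v i" and ?j = "backport G v i"
      let ?Y = "oB G a v i" and ?Z = "oB G a ?u ?j"
      have u: "?u \<in> verts G" "?u \<noteq> v" using nbr_in nbr_neq v by auto
      note bp = backport[OF v] backport_backport[OF v]
      have sel: "fst (sel Y Z) \<in> Y \<and> snd (sel Y Z) \<in> Z \<and>
          {#fst (sel Y Z), snd (sel Y Z)#} \<in> edgec (half P) D"
        if "{#Y, Z#} \<in> edgec (one P) D" for Y Z
      proof -
        have "\<exists>yz. fst yz \<in> Y \<and> snd yz \<in> Z \<and> {#fst yz, snd yz#} \<in> edgec (half P) D"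
          using that by (auto simp: edgec_one_iff)
        then show ?thesis unfolding sel_def by (rule someI_ex)
      qed
      have "a v \<noteq> a ?u"
        using G(2) u v by (auto dest: inj_onD)
      then consider "a v < a ?u" | "a ?u < a v" by linarith
      then show ?thesis
      proof cases
        case 1
        then have "c G a v i = fst (sel ?Y ?Z)" "c G a ?u ?j = snd (sel ?Y ?Z)"
          using v bp by (auto simp: c_def Let_def)
        then show ?thesis using sel[OF edgeB[OF v]] by simp
      next
        case 2
        then have "c G a v i = snd (sel ?Z ?Y)" "c G a ?u ?j = fst (sel ?Z ?Y)"
          using v bp by (auto simp: c_def Let_def)
        moreover have "{#?Z, ?Y#} \<in> edgec (one P) D"
          using edgeB[OF v] by (simp add: add_mset_commute)
        ultimately show ?thesis using sel[of ?Z ?Y] by (simp add: add_mset_commute)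
      qed
    qed
    have x: "(\<forall>i<deg G v. x v i \<in> c G a v i) \<and> mset (map (x v) [0..<deg G v]) \<in> nodec P D"
      if v: "v \<in> verts G" for v
    proof -
      let ?d = "deg G v"
      have "rel_mset (\<lambda>Y y. y \<in> Y) (mset (map (oB G a v) [0..<?d])) (mset (map (c G a v) [0..<?d]))"
        using c[OF v] by (intro rel_mset_mapI) simp
      then have "mset (map (c G a v) [0..<?d]) \<in> nodec (half P) D"
        using nodeB[OF v] unfolding nodec_one_iff allnode_def by blast
      then obtain N where N: "N \<in> nodec P D"
          "rel_mset (\<lambda>Y y. y \<in> Y) (mset (map (c G a v) [0..<?d])) N"
        by (auto simp: half_def)
      obtain g where "N = mset (map g [0..<?d])" "\<And>i. i < ?d \<Longrightarrow> g i \<in> c G a v i"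
        using rel_mset_mapE[OF N(2)] by blast
      then have "\<exists>g. (\<forall>i<?d. g i \<in> c G a v i) \<and> mset (map g [0..<?d]) \<in> nodec P D"
        using N(1) by blast
      then show ?thesis unfolding x_def pick_def by (rule someI_ex)
    qed
    have edge: "x v i \<in> outs P D \<and> {#x v i, x (nbr G v i) (backport G v i)#} \<in> edgec P D"
      if v: "v \<in> verts G" "i < deg G v" for v i
    proof -
      have "x v i \<in> c G a v i"
        "x (nbr G v i) (backport G v i) \<in> c G a (nbr G v i) (backport G v i)"
        using x[OF v(1)] x[OF nbr_in[OF v]] v(2) backport(1)[OF v] by auto
      then show ?thesis
        using c[OF v] unfolding edgec_half_iff allcomp_def by blast
    qed
    show ?thesis
      unfolding solves_on_def Let_def using edge x AX nbr_in by (simp del: pview.simps mset_map)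
  qed
  then show ?thesis
    using A by (auto simp: solves_with_ids_def)
qed

section \<open>Simultaneous realizations and the gain of one round\<close>

locale independent_class =
  fixes C :: "('v, 'l) pgraph set" and S :: "nat set" and n k :: nat
  assumes graphs: "\<And>G. G \<in> C \<Longrightarrow> port_graph G"
    and girth: "\<And>G. G \<in> C \<Longrightarrow> girth_ge G (2 * k + 4)"
    and finite_verts: "\<And>G. G \<in> C \<Longrightarrow> finite (verts G)"
    and card_verts: "\<And>G. G \<in> C \<Longrightarrow> card (verts G) = n"
    and finite_ids: "finite S"
    and indep: "t_independent C (Suc k)"
begin

text \<open>A realization embeds \<open>n\<close> nodes into \<open>S\<close>, and all graphs of the
  class have \<open>n\<close> nodes; so \<open>S\<close> has room for any graph that independence
  supplies.\<close>

lemma realizations_card: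
  assumes "(G, a, v) \<in> realizations C S" "H \<in> C"
  shows "card (verts H) \<le> card S"
  using assms card_inj_on_le[of a "verts G" S] card_verts[of G] card_verts[of H] finite_ids
  by (auto simp: realizations_def)

text \<open>Carries the identifiers of \<open>H1\<close> back to \<open>H\<close>. By girth both
  views list each node once, and equal shape matches the nodes; \<open>r\<close> is meaningful only
  on the nodes seen from \<open>w\<close>.\<close>

lemma relabel_pview:
  assumes H: "H \<in> C" "w \<in> verts H" and r1: "(H1, b, w1) \<in> realizations C S"
    and eq: "nview (Suc k) H w = nview (Suc k) H1 w1"
  obtains r where "pview (Suc k) H r w None = pview (Suc k) H1 b w1 None"
    "inj_on r (vis (Suc k) H w None)"
proof -
  have 1: "H1 \<in> C" "w1 \<in> verts H1" "inj_on b (verts H1)"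
    using r1 by (auto simp: realizations_def)
  let ?V = "pview (Suc k) H (\<lambda>x. x) w None" and ?W = "pview (Suc k) H1 b w1 None"
  have "map_view (\<lambda>_. ()) id ?V = map_view (\<lambda>_. ()) id ?W"
    using eq by (simp add: nview_def pview_map comp_def del: pview.simps)
  moreover have "distinct (labels ?V)"
    by (rule port_graph.distinct_labels_pview[OF graphs girth]) (use H in auto)
  moreover have "distinct (labels ?W)"
    unfolding pview_eq_map[of "Suc k" H1 b]
    by (rule port_graph.distinct_labels_ids[OF graphs _ port_graph.distinct_labels_pview[OF graphs girth]])
      (use 1 port_graph.vis_subset_verts[OF graphs, of H1 w1 "Suc k" None] in
        \<open>auto simp: vis_def simp del: pview.simps\<close>)
  ultimately obtain r where "map_view r id ?V = ?W" "inj_on r (set1_view ?V)"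
    by (rule relabel_view)
  then show thesis
    by (intro that[of r]) (simp_all add: pview_map comp_def vis_def del: pview.simps)
qed

lemma relabel_epview:
  assumes H: "H \<in> C" "w \<in> verts H" "i < deg H w"
    and r1: "(H1, b, w1) \<in> realizations C S" "i < deg H1 w1"
    and eq: "epview k H (\<lambda>_. ()) w i = epview k H1 (\<lambda>_. ()) w1 i"
  obtains r where "epview k H r w i = epview k H1 b w1 i" "inj_on r (evis k H w i)"
proof -
  have 1: "H1 \<in> C" "w1 \<in> verts H1" "inj_on b (verts H1)"
    using r1 by (auto simp: realizations_def)
  let ?V = "epview k H (\<lambda>x. x) w i" and ?W = "epview k H1 b w1 i"
  have "map_view (\<lambda>_. ()) id ?V = map_view (\<lambda>_. ()) id ?W"
    using eq by (simp add: epview_map comp_def)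
  moreover have "distinct (labels ?V)"
    by (rule port_graph.distinct_labels_epview[OF graphs girth]) (use H in auto)
  moreover have "distinct (labels (map_view b id (epview k H1 (\<lambda>x. x) w1 i)))"
  proof (rule port_graph.distinct_labels_ids[OF graphs])
    show "distinct (labels (epview k H1 (\<lambda>x. x) w1 i))"
      by (rule port_graph.distinct_labels_epview[OF graphs girth]) (use 1 r1 in auto)
    show "set1_view (epview k H1 (\<lambda>x. x) w1 i) \<subseteq> verts H1"
      using port_graph.vis_subset_verts[OF graphs[OF 1(1)]] 1
        port_graph.nbr_in[OF graphs[OF 1(1)] 1(2) r1(2)] by (simp add: set1_epview evis_def)
  qed (use 1 in auto)
  then have "distinct (labels ?W)"
    by (simp add: epview_map comp_def)
  ultimately obtain r where "map_view r id ?V = ?W" "inj_on r (set1_view ?V)"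
    by (rule relabel_view)
  then show thesis
    by (intro that[of r]) (simp_all add: epview_map comp_def set1_epview)
qed

text \<open>Part (i) of independence gives the unlabelled graph. The identifiers of the two
  realizations, carried back to the balls around \<open>w\<close> and its neighbour, have the same
  order on the intersection, because \<open>eq\<close> speaks about just these nodes; amalgamation
  and extension into \<open>S\<close> finish.\<close>

lemma edge_realization:
  assumes r1: "(H1, b1, v1) \<in> realizations C S" "i < deg H1 v1"
    and r2: "(H2, b2, v2) \<in> realizations C S" "i < deg H2 v2"
    and eq: "order_equiv (epview k H1 b1 v1 i) (epview k H2 b2 v2 i)"
  obtains H b w where "(H, b, w) \<in> realizations C S" "i < deg H w"
    "backport H w i = backport H1 v1 i"
    "order_equiv (pview (Suc k) H1 b1 v1 None) (pview (Suc k) H b w None)"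
    "order_equiv (pview (Suc k) H2 b2 (nbr H2 v2 i) None) (pview (Suc k) H b (nbr H w i) None)"
proof -
  have 1: "H1 \<in> C" "v1 \<in> verts H1" and 2: "H2 \<in> C" "v2 \<in> verts H2"
    using r1 r2 by (auto simp: realizations_def)
  have "epview k H1 (\<lambda>_. ()) v1 i = epview k H2 (\<lambda>_. ()) v2 i"
    using order_equiv_shape[OF eq] by (simp add: epview_map comp_def)
  then have "edge_view (Suc k) H2 v2 i = edge_view (Suc k) H1 v1 i"
    by (simp add: edge_view_eq_iff)
  then obtain H w where H: "H \<in> C" "w \<in> verts H" "i < deg H w"
      and n1: "nview (Suc k) H w = nview (Suc k) H1 v1"
      and n2: "nview (Suc k) H (nbr H w i) = nview (Suc k) H2 (nbr H2 v2 i)"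
    using indep 1 2 r1(2) r2(2) unfolding t_independent_def by metis
  interpret H: port_graph H using graphs H by blast
  let ?u = "nbr H w i" and ?j = "backport H w i" and ?u2 = "nbr H2 v2 i"
  have u: "?u \<in> verts H" using H.nbr_in H by blast
  have u2: "(H2, b2, ?u2) \<in> realizations C S"
    using r2 port_graph.nbr_in[OF graphs[OF 2(1)] 2(2) r2(2)] by (auto simp: realizations_def)
  obtain q1 where q1: "pview (Suc k) H q1 w None = pview (Suc k) H1 b1 v1 None"
      "inj_on q1 (vis (Suc k) H w None)"
    using relabel_pview[OF H(1,2) r1(1) n1] by blast
  obtain q2 where q2: "pview (Suc k) H q2 ?u None = pview (Suc k) H2 b2 ?u2 None"
      "inj_on q2 (vis (Suc k) H ?u None)"
    using relabel_pview[OF H(1) u u2 n2] by blast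
  have e1: "epview k H q1 w i = epview k H1 b1 v1 i"
    using q1(1) H(3) by (rule epview_eq_of_pview_eq)
  then have bp1: "?j = backport H1 v1 i"
    by (simp add: epview_def)
  also have "\<dots> = backport H2 v2 i"
    using eq by (rule order_equiv_backport)
  finally have bp2: "?j = backport H2 v2 i" .
  note bp = H.backport[OF H(2,3)] H.backport_backport[OF H(2,3)]
  note bp' = port_graph.backport[OF graphs[OF 2(1)] 2(2) r2(2)]
    port_graph.backport_backport[OF graphs[OF 2(1)] 2(2) r2(2)]
  have "epview k H q2 ?u ?j = epview k H2 b2 ?u2 ?j"
    using q2(1) bp(1) by (rule epview_eq_of_pview_eq)
  then have e2: "epview k H q2 w i = epview k H2 b2 v2 i"
    using bp bp' bp2 by (auto simp: epview_def)
  have "order_equiv (epview k H q1 w i) (epview k H q2 w i)"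
    using eq e1 e2 by simp
  then have "same_order (vis (Suc k) H w None \<inter> vis (Suc k) H ?u None) q1 q2"
    by (simp only: order_equiv_epview_iff H.vis_inter_nbr[OF girth[OF H(1)] H(2,3)])
  then obtain f where f: "inj_on f (vis (Suc k) H w None \<union> vis (Suc k) H ?u None)"
      "same_order (vis (Suc k) H w None) q1 f" "same_order (vis (Suc k) H ?u None) q2 f"
    using same_order_amalgam[OF finite_vis finite_vis q1(2) q2(2)] by blast
  have "vis (Suc k) H w None \<union> vis (Suc k) H ?u None \<subseteq> verts H"
    using H.vis_subset_verts H(2) u by simp
  then obtain b where b: "inj_on b (verts H)" "b ` verts H \<subseteq> S"
      "same_order (vis (Suc k) H w None \<union> vis (Suc k) H ?u None) f b"
    using same_order_extend_into[OF finite_verts[OF H(1)] _ f(1) finite_ids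
        realizations_card[OF r1(1) H(1)]] by blast
  have "same_order (vis (Suc k) H w None) q1 b"
    using f(2) same_order_subset[OF b(3)] by (rule same_order_trans) simp
  then have "order_equiv (pview (Suc k) H1 b1 v1 None) (pview (Suc k) H b w None)"
    unfolding q1(1)[symmetric] order_equiv_pview_iff .
  moreover have "same_order (vis (Suc k) H ?u None) q2 b"
    using f(3) same_order_subset[OF b(3)] by (rule same_order_trans) simp
  then have "order_equiv (pview (Suc k) H2 b2 ?u2 None) (pview (Suc k) H b ?u None)"
    unfolding q2(1)[symmetric] order_equiv_pview_iff .
  moreover have "(H, b, w) \<in> realizations C S"
    using H b by (simp add: realizations_def)
  ultimately show thesis
    using that H(3) bp1 by blast
qed

text \<open>The same scheme at a node, by part (ii) of independence. The edge neighbourhoods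
  pairwise meet in the ball of radius \<open>k\<close>, where the orders carried back agree because
  all realizations share the order type of that view.\<close>

lemma node_realization:
  assumes r0: "(G, a, v) \<in> realizations C S"
    and rs: "\<And>i. i < deg G v \<Longrightarrow> (Hs i, bs i, ws i) \<in> realizations C S"
    and eq: "\<And>i. i < deg G v \<Longrightarrow> order_equiv (pview k G a v None) (pview k (Hs i) (bs i) (ws i) None)"
  obtains H b w where "(H, b, w) \<in> realizations C S" "deg H w = deg G v"
    "\<And>i. i < deg G v \<Longrightarrow> order_equiv (epview k (Hs i) (bs i) (ws i) i) (epview k H b w i)"
proof -
  have G: "G \<in> C" "v \<in> verts G"
    using r0 by (auto simp: realizations_def)
  have Hs: "Hs i \<in> C \<and> ws i \<in> verts (Hs i) \<and> nview (Suc k - 1) (Hs i) (ws i) = nview (Suc k - 1) G v"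
    if "i < deg G v" for i
    using rs[OF that] nview_eq_of_order_equiv[OF eq[OF that]] by (auto simp: realizations_def)
  have dHs: "i < deg (Hs i) (ws i)" if "i < deg G v" for i
    using order_equiv_deg[OF eq[OF that]] that by simp
  obtain H w where H: "H \<in> C" "w \<in> verts H" and nH: "nview k H w = nview k G v"
      and eH: "\<And>i. i < deg G v \<Longrightarrow> edge_view (Suc k) H w i = edge_view (Suc k) (Hs i) (ws i) i"
    using indep[unfolded t_independent_def, THEN conjunct2, THEN bspec, OF G(1), THEN bspec,
        OF G(2), THEN spec, of Hs, THEN spec, of ws] Hs by auto
  interpret H: port_graph H using graphs H by blast
  have d: "deg H w = deg G v"
    using nH unfolding nview_def by (rule pview_eq_deg)
  have "\<exists>r. epview k H r w i = epview k (Hs i) (bs i) (ws i) i \<and> inj_on r (evis k H w i)"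
    if i: "i < deg G v" for i
  proof -
    have "epview k H (\<lambda>_. ()) w i = epview k (Hs i) (\<lambda>_. ()) (ws i) i"
      using eH[OF i] by (simp add: edge_view_eq_iff)
    then show ?thesis
      using relabel_epview[OF H _ rs[OF i] dHs[OF i]] d i by metis
  qed
  then obtain r where r: "\<And>i. i < deg G v \<Longrightarrow> epview k H (r i) w i = epview k (Hs i) (bs i) (ws i) i"
      and rinj: "\<And>i. i < deg G v \<Longrightarrow> inj_on (r i) (evis k H w i)"
    by metis
  have so: "same_order (vis k H w None) (r i) (r l)" if il: "i < deg G v" "l < deg G v" for i l
  proof -
    have "order_equiv (pview k (Hs i) (bs i) (ws i) None) (pview k (Hs l) (bs l) (ws l) None)"
      using order_equiv_trans[OF order_equiv_sym[OF eq[OF il(1)]] eq[OF il(2)]] .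
    then show ?thesis
      unfolding pview_eq_of_epview_eq[OF r[OF il(1)], symmetric]
        pview_eq_of_epview_eq[OF r[OF il(2)], symmetric] order_equiv_pview_iff .
  qed
  have core: "evis k H w i \<inter> evis k H w l = vis k H w None"
    if "i < deg G v" "l < deg G v" "i \<noteq> l" for i l
    using H.evis_inter[OF girth[OF H(1)] H(2)] that d by simp
  have fin: "finite (evis k H w i)" for i
    by (simp add: evis_def finite_vis)
  obtain f where f: "inj_on f (\<Union>i<deg G v. evis k H w i)"
      "\<And>i. i < deg G v \<Longrightarrow> same_order (evis k H w i) (r i) f"
    using same_order_star_amalgam[of "deg G v" "evis k H w" r "vis k H w None", OF fin rinj core so]
    by blast
  have "(\<Union>i<deg G v. evis k H w i) \<subseteq> verts H"
    using H.vis_subset_verts H.nbr_in H(2) d by (intro UN_least) (simp add: evis_def)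
  then obtain b where b: "inj_on b (verts H)" "b ` verts H \<subseteq> S"
      "same_order (\<Union>i<deg G v. evis k H w i) f b"
    using same_order_extend_into[OF finite_verts[OF H(1)] _ f(1) finite_ids
        realizations_card[OF r0 H(1)]] by blast
  have "order_equiv (epview k (Hs i) (bs i) (ws i) i) (epview k H b w i)" if "i < deg G v" for i
  proof -
    have "same_order (evis k H w i) (r i) b"
      using f(2)[OF that] same_order_subset[OF b(3)] by (rule same_order_trans) (use that in auto)
    then show ?thesis
      unfolding r[OF that, symmetric] order_equiv_epview_iff .
  qed
  moreover have "(H, b, w) \<in> realizations C S"
    using H b by (simp add: realizations_def)
  ultimately show thesis
    using that d by blast
qed

lemma speedup:
  fixes P :: "'o lcl_problem" and A :: "(nat, 'l) view \<Rightarrow> nat \<Rightarrow> 'o"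
  assumes deg_le: "\<And>G v. G \<in> C \<Longrightarrow> v \<in> verts G \<Longrightarrow> deg G v \<le> D"
    and inv: "order_invariant A" and sol: "solves_with_ids P D A (Suc k) C S"
  shows "\<exists>B :: (nat, 'l) view \<Rightarrow> nat \<Rightarrow> 'o set set.
    order_invariant B \<and> solves_with_ids (one P) D B k C S"
proof -
  let ?R = "realizations C S"
  define oA where "oA G a v = A (pview (Suc k) G a v None)" for G :: "('v, 'l) pgraph" and a v
  have outA: "oA G a v i \<in> outs P D"
    and edgeA: "{#oA G a v i, oA G a (nbr G v i) (backport G v i)#} \<in> edgec P D"
    if "(G, a, v) \<in> ?R" "i < deg G v" for G a v i
    using sol that unfolding solves_with_ids_def solves_on_def Let_def realizations_def oA_def
    by (auto simp del: pview.simps)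
  have nodeA: "mset (map (oA G a v) [0..<deg G v]) \<in> nodec P D" if "(G, a, v) \<in> ?R" for G a v
    using sol that unfolding solves_with_ids_def solves_on_def Let_def realizations_def oA_def
    by (auto simp del: pview.simps mset_map)
  \<comment> \<open>The sets \<open>hs\<close> play the role of a solution of \<open>half P\<close>.
    They depend on the order type of an edge neighbourhood, which a view of radius \<open>k\<close>
    need not determine; \<open>ns\<close> collects the possibilities left open.\<close>
  define hs where "hs G a v i = {oA H b w i | H b w. (H, b, w) \<in> ?R \<and> i < deg H w \<and>
    order_equiv (epview k G a v i) (epview k H b w i)}" for G :: "('v, 'l) pgraph" and a v i
  have hs_eq: "hs G a v i = hs H b w i" if "order_equiv (epview k G a v i) (epview k H b w i)"
    for G a v i H b w
  proof -
    have "order_equiv (epview k G a v i) W \<longleftrightarrow> order_equiv (epview k H b w i) W" for W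
      using that order_equiv_sym order_equiv_trans by blast
    then show ?thesis by (simp add: hs_def)
  qed
  have hs_out: "hs G a v i \<subseteq> outs P D" for G a v i
    using outA by (auto simp: hs_def)
  define ns where "ns G a v i = {hs H b w i | H b w. (H, b, w) \<in> ?R \<and> i < deg H w \<and>
    order_equiv (pview k G a v None) (pview k H b w None)}" for G :: "('v, 'l) pgraph" and a v i
  have ns_out: "ns G a v i \<subseteq> Pow (outs P D)" for G a v i
    by (auto simp: ns_def dest!: subsetD[OF hs_out])
  have "(\<lambda>(G, a, v). ns G a v) r = (\<lambda>(G, a, v). ns G a v) s"
    if rs: "r \<in> ?R" "s \<in> ?R" and eq: "order_equiv ((\<lambda>(G, a, v). pview k G a v None) r)
        ((\<lambda>(G, a, v). pview k G a v None) s)" for r s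
  proof -
    obtain G a v where r: "r = (G, a, v)" by (cases r)
    obtain G' a' v' where s: "s = (G', a', v')" by (cases s)
    have "order_equiv (pview k G a v None) W \<longleftrightarrow> order_equiv (pview k G' a' v' None) W" for W
      using eq order_equiv_sym order_equiv_trans unfolding r s split_conv by blast
    then show ?thesis by (simp add: r s ns_def[abs_def])
  qed
  then obtain B where B: "order_invariant B"
      and BF: "\<And>r. r \<in> ?R \<Longrightarrow> B ((\<lambda>(G, a, v). pview k G a v None) r) = (\<lambda>(G, a, v). ns G a v) r"
    by (rule order_invariant_extension[where R = ?R and F = "\<lambda>(G, a, v). ns G a v"
          and vw = "\<lambda>(G, a, v). pview k G a v None"]) blast+
  have Bns: "B (pview k G a v None) = ns G a v" if "(G, a, v) \<in> ?R" for G a v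
    using BF[OF that] by simp
  have edge: "{#ns G a v i, ns G a (nbr G v i) (backport G v i)#} \<in> edgec (one P) D"
    if r: "(G, a, v) \<in> ?R" "i < deg G v" for G a v i
  proof -
    let ?u = "nbr G v i" and ?j = "backport G v i"
    have G: "G \<in> C" "v \<in> verts G" using r by (auto simp: realizations_def)
    interpret port_graph G using graphs G by blast
    have u: "(G, a, ?u) \<in> ?R" "?j < deg G ?u"
      using r nbr_in backport(1) G by (auto simp: realizations_def)
    have "{#x, y#} \<in> edgec P D" if "x \<in> hs G a v i" "y \<in> hs G a ?u ?j" for x y
    proof -
      obtain H1 b1 w1 where h1: "(H1, b1, w1) \<in> ?R" "i < deg H1 w1"
          "order_equiv (epview k G a v i) (epview k H1 b1 w1 i)" "x = oA H1 b1 w1 i"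
        using \<open>x \<in> hs G a v i\<close> by (auto simp: hs_def)
      obtain H2 b2 w2 where h2: "(H2, b2, w2) \<in> ?R" "?j < deg H2 w2"
          "order_equiv (epview k G a ?u ?j) (epview k H2 b2 w2 ?j)" "y = oA H2 b2 w2 ?j"
        using \<open>y \<in> hs G a ?u ?j\<close> by (auto simp: hs_def)
      have H2: "H2 \<in> C" "w2 \<in> verts H2" using h2 by (auto simp: realizations_def)
      interpret H2: port_graph H2 using graphs H2 by blast
      \<comment> \<open>The second realization is given from the other endpoint; reading it from
        \<open>?v2\<close> orients both edge neighbourhoods alike.\<close>
      let ?v2 = "nbr H2 w2 ?j"
      have i: "backport H2 w2 ?j = i"
        using order_equiv_backport[OF h2(3)] backport_backport[OF G(2) r(2)] by simp
      have v2: "(H2, b2, ?v2) \<in> ?R" "i < deg H2 ?v2" "nbr H2 ?v2 i = w2"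
        using h2(1) H2.nbr_in[OF H2(2) h2(2)] H2.backport[OF H2(2) h2(2)] i
        by (auto simp: realizations_def)
      have "order_equiv (epview k G a v i) (epview k H2 b2 ?v2 i)"
        using order_equiv_swap[OF graphs[OF G(1)] graphs[OF H2(1)] nbr_in[OF G(2) r(2)] u(2)
            H2(2) h2(2) h2(3)] backport[OF G(2) r(2)] backport_backport[OF G(2) r(2)] i by simp
      then have "order_equiv (epview k H1 b1 w1 i) (epview k H2 b2 ?v2 i)"
        using order_equiv_trans[OF order_equiv_sym[OF h1(3)]] by blast
      then obtain H b w where H: "(H, b, w) \<in> ?R" "i < deg H w"
          "backport H w i = backport H1 w1 i"
          "order_equiv (pview (Suc k) H1 b1 w1 None) (pview (Suc k) H b w None)"
          "order_equiv (pview (Suc k) H2 b2 w2 None) (pview (Suc k) H b (nbr H w i) None)"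
        using edge_realization[OF h1(1,2) v2(1,2)] unfolding v2(3) by metis
      have "x = oA H b w i" "y = oA H b (nbr H w i) ?j"
        using order_invariantD[OF inv H(4)] order_invariantD[OF inv H(5)] h1(4) h2(4)
        by (simp_all add: oA_def del: pview.simps)
      then show ?thesis
        using edgeA[OF H(1,2)] H(3) order_equiv_backport[OF h1(3)] by simp
    qed
    then have "{#hs G a v i, hs G a ?u ?j#} \<in> edgec (half P) D"
      using hs_out by (auto simp: edgec_half_iff allcomp_def)
    \<comment> \<open>\<open>G\<close> itself is among the realizations, so the sets of the actual
      edge provide the compatible pair that the edge constraint of \<open>one P\<close> asks
      for.\<close>
    moreover have "hs G a v i \<in> ns G a v i" "hs G a ?u ?j \<in> ns G a ?u ?j"
      using r u order_equiv_refl unfolding ns_def by blast+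
    ultimately show ?thesis
      unfolding edgec_one_iff using ns_out by blast
  qed
  have node: "mset (map (ns G a v) [0..<deg G v]) \<in> nodec (one P) D" if r: "(G, a, v) \<in> ?R" for G a v
  proof -
    let ?d = "deg G v"
    have G: "G \<in> C" "v \<in> verts G" using r by (auto simp: realizations_def)
    have "N \<in> nodec (half P) D"
      if N: "rel_mset (\<lambda>Y y. y \<in> Y) (mset (map (ns G a v) [0..<?d])) N" for N
    proof -
      obtain y where y: "N = mset (map y [0..<?d])" "\<And>i. i < ?d \<Longrightarrow> y i \<in> ns G a v i"
        using rel_mset_mapE[OF N] by blast
      have "\<forall>i. \<exists>H b w. i < ?d \<longrightarrow> y i = hs H b w i \<and> (H, b, w) \<in> ?R \<and>
          order_equiv (pview k G a v None) (pview k H b w None)"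
        using y(2) by (auto simp: ns_def) metis
      then obtain Hs bs ws where hs: "\<And>i. i < ?d \<Longrightarrow> y i = hs (Hs i) (bs i) (ws i) i"
          "\<And>i. i < ?d \<Longrightarrow> (Hs i, bs i, ws i) \<in> ?R"
          "\<And>i. i < ?d \<Longrightarrow> order_equiv (pview k G a v None) (pview k (Hs i) (bs i) (ws i) None)"
        by metis
      \<comment> \<open>The \<open>y i\<close> may stem from different graphs. In \<open>H\<close>
        all their edge neighbourhoods meet at one node, so the outputs there form a selection from
        the \<open>y i\<close>, valid because the given algorithm is correct on
        \<open>H\<close>.\<close>
      obtain H b w where H: "(H, b, w) \<in> ?R" "deg H w = ?d"
          "\<And>i. i < ?d \<Longrightarrow> order_equiv (epview k (Hs i) (bs i) (ws i) i) (epview k H b w i)"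
        using node_realization[OF r, of Hs bs ws] hs(2,3) by blast
      have "oA H b w i \<in> y i" if "i < ?d" for i
        using H(1,2) H(3)[OF that] that unfolding hs(1)[OF that] hs_def by force
      then have "rel_mset (\<lambda>Y y. y \<in> Y) N (mset (map (oA H b w) [0..<?d]))"
        unfolding y(1) by (rule rel_mset_mapI)
      moreover have "mset (map (oA H b w) [0..<?d]) \<in> nodec P D"
        using nodeA[OF H(1)] H(2) by simp
      moreover have "size N \<le> D"
        using deg_le[OF G] by (simp add: y(1))
      moreover have "set_mset N \<subseteq> Pow (outs P D)"
        using hs(1) by (auto simp: y(1) dest!: subsetD[OF hs_out])
      ultimately show ?thesis
        by (auto simp: half_def)
    qed
    moreover have "set_mset (mset (map (ns G a v) [0..<?d])) \<subseteq> Pow (Pow (outs P D))"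
      by (auto dest!: subsetD[OF ns_out])
    ultimately show ?thesis
      using deg_le[OF G] by (simp add: nodec_one_iff allnode_def)
  qed
  have "solves_on (one P) D B k G a"
    if G: "G \<in> C" "inj_on a (verts G)" "a ` verts G \<subseteq> S" for G a
  proof -
    have R: "(G, a, v) \<in> ?R" if "v \<in> verts G" for v
      using G that by (simp add: realizations_def)
    have "nbr G v i \<in> verts G" if "v \<in> verts G" "i < deg G v" for v i
      using port_graph.nbr_in[OF graphs[OF G(1)]] that by blast
    then show ?thesis
      unfolding solves_on_def Let_def using edge[OF R] node[OF R] Bns[OF R]
      by (simp add: edgec_one_iff del: mset_map)
  qed
  then show ?thesis
    using B by (auto simp: solves_with_ids_def)
qed

end

lemma port_graph_of_class: "in_graph_class n D Sig G \<Longrightarrow> port_graph G"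
  unfolding in_graph_class_def port_graph_def by blast

theorem theorem4:
  fixes P :: "'o lcl_problem"
    and C :: "('v, 'l) pgraph set"
    and Sig :: "'l set"
    and n D t :: nat
    and S :: "nat set"
  assumes "wf_problem P"
    and "finite Sig"
    and "\<forall>G\<in>C. in_graph_class n D Sig G"
    and "t > 0"
    and "t_independent C t"
    and "\<forall>G\<in>C. girth_ge G (2 * t + 2)"
    and "finite S" and "0 \<notin> S"
    and "card S \<ge> 4 * D ^ (2 * t)"
  shows "((\<exists>A :: (nat, 'l) view \<Rightarrow> nat \<Rightarrow> 'o.
              order_invariant A \<and> solves_with_ids P D A t C S)
          \<longleftrightarrow> (\<exists>A :: (nat, 'l) view \<Rightarrow> nat \<Rightarrow> 'o set set.
              order_invariant A \<and> solves_with_ids (one P) D A (t - 1) C S))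
       \<and> ((\<exists>A :: (nat, 'l) view \<Rightarrow> nat \<Rightarrow> 'o set set.
              order_invariant A \<and> solves_with_ids (one P) D A (t - 1) C S)
          \<longleftrightarrow> (\<exists>A :: (nat, 'l) view \<Rightarrow> nat \<Rightarrow> 'o set set.
              order_invariant A \<and> solves_with_ids (one' P) D A (t - 1) C S))"
proof -
  obtain k where t: "t = Suc k" using assms(4) by (cases t) auto
  have graphs: "port_graph G" if "G \<in> C" for G
    using assms(3) that port_graph_of_class by blast
  \<comment> \<open>With \<open>t = Suc k\<close> the girth bound \<open>2 * t + 2\<close> becomes
    the \<open>2 * k + 4\<close> of the locale.\<close>
  interpret independent_class C S n k
    using graphs assms(3,5,6,7)
    by unfold_locales (auto simp: t in_graph_class_def numeral_eq_Suc)
  have deg_le: "deg G v \<le> D" if "G \<in> C" "v \<in> verts G" for G v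
    using assms(3) that by (auto simp: in_graph_class_def)
  have fin: "finite (outs P D)"
    using assms(1) by (simp add: wf_problem_def)
  show ?thesis
    unfolding t diff_Suc_1
    using speedup[OF deg_le] slowdown[OF graphs] one'_of_one[OF fin graphs] solves_one_of_one'
    by metis
qed

end
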